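(* Let $X=L^2[0,1]$, let $V:X\to X$ be the Volterra integration operator $(Vx)(t)=\int_0^tx$, and define $T=V^{-1}$; $S=\tfrac{T-T^*}{2}$ with $\operatorname{dom}S=\operatorname{dom}T\cap\operatorname{dom}T^*$; $T_1x=x'$ with $\operatorname{dom}T_1=\{x\in L^2[0,1]: x\text{ is absolutely continuous},\ x(0)=x(1),\ x'\in L^2[0,1]\}$; and $T_2=\big(\tfrac{V-V^*}{2}\big)^{-1}$. Then: The domain of the skew operator $S$ is dense in $L^2[0,1]$. Neither $S$ nor $-S$ is maximal monotone. Neither $S^*$ nor $-S^*$ is monotone. The linear operators $S,T,T_1,T_2$ satisfy $$\operatorname{gra}S\subsetneqq\operatorname{gra}T\subsetneqq\operatorname{gra}(-S^* ),$$ $$\operatorname{gra}S\subsetneqq\operatorname{gra}T_1\subsetneqq\operatorname{gra}(-S^* ),$$ $$\operatorname{gra}S\subsetneqq\operatorname{gra}T_2\subsetneqq\operatorname{gra}(-S^* ).$$ While $S$ is skew, $T,T_1,T_2$ are maximal monotone and $T_1,T_2$ are skew. Also, $$\operatorname{gra}(-S)\subsetneqq\operatorname{gra}(T^* )\subsetneqq\operatorname{gra}S^*,$$ $$\operatorname{gra}(-S)\subsetneqq\operatorname{gra}(-T_1)\subsetneqq\operatorname{gra}S^*,$$ $$\operatorname{gra}(-S)\subsetneqq\operatorname{gra}(-T_2)\subsetneqq\operatorname{gra}S^*.$$ While $-S$ is skew, $T^*,-T_1,-T_2$ are maximal monotone and $-T_1,-T_2$ are skew.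
   Context: $L^2[0,1]$ is the real Hilbert space of (classes of) square-integrable real functions on $[0,1]$ with inner product $\langle x,y\rangle=\int_0^1xy$. An element is called absolutely continuous if it has an absolutely continuous representative on $[0,1]$; point values $x(0),x(1)$ refer to that representative, and $x'$ is its (a.e.) derivative. The adjoint of $V$ is $(V^*x)(t)=\int_t^1x$; both $V$ and $\tfrac{V-V^*}{2}$ are injective. For a set-valued operator $A:X\rightrightarrows X$, $\operatorname{gra}A=\{(x,x^* )\in X\times X\mid x^*\in Ax\}$, $\operatorname{dom}A=\{x\mid Ax\ne\varnothing\}$, $A^{-1}$ is the operator with graph $\{(x^*,x)\mid(x,x^* )\in\operatorname{gra}A\}$, and $\operatorname{gra}(-A)=\{(x,-x^* )\mid(x,x^* )\in\operatorname{gra}A\}$. At most single-valued linear relations (operators whose graph is a linear subspace) are identified with linear operators on their domains. $A$ is monotone if $\langle x-y,x^*-y^*\rangle\ge0$ for all $(x,x^* ),(y,y^* )\in\operatorname{gra}A$, and maximal monotone if monotone with no proper monotone enlargement (in the sense of graph inclusion). For a linear relation $A$, the adjoint $A^*$ is defined by $\operatorname{gra}A^*=\{(x,x^* )\mid(x^*,-x)\in(\operatorname{gra}A)^\perp\}$, and $A$ is skew if $\langle x,x^*\rangle=0$ for all $(x,x^* )\in\operatorname{gra}A$. *)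

theory Defs
  imports "HOL-Analysis.Analysis"
begin

definition square_integrable :: "(real \<Rightarrow> real) \<Rightarrow> bool" where
  "square_integrable f \<longleftrightarrow>
     f \<in> borel_measurable (lebesgue_on {0..1}) \<and>
     integrable (lebesgue_on {0..1}) (\<lambda>t. (f t)\<^sup>2)"

lemma square_integrable_mult:
  assumes "square_integrable f" "square_integrable g"
  shows "integrable (lebesgue_on {0..1}) (\<lambda>t. f t * g t)"
proof -
  have [measurable]: "f \<in> borel_measurable (lebesgue_on {0..1})"
    "g \<in> borel_measurable (lebesgue_on {0..1})"
    using assms by (auto simp: square_integrable_def)
  have "integrable (lebesgue_on {0..1}) (\<lambda>t. (f t)\<^sup>2 + (g t)\<^sup>2)"
    using assms by (auto simp: square_integrable_def)
  then show ?thesis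
  proof (rule Bochner_Integration.integrable_bound)
    show "AE t in lebesgue_on {0..1}. norm (f t * g t) \<le> norm ((f t)\<^sup>2 + (g t)\<^sup>2)"
    proof (rule AE_I2)
      fix t
      have "2 * (\<bar>f t\<bar> * \<bar>g t\<bar>) \<le> (f t)\<^sup>2 + (g t)\<^sup>2"
        using sum_squares_bound[of "\<bar>f t\<bar>" "\<bar>g t\<bar>"] by simp
      moreover have "0 \<le> \<bar>f t\<bar> * \<bar>g t\<bar>" by simp
      ultimately show "norm (f t * g t) \<le> norm ((f t)\<^sup>2 + (g t)\<^sup>2)"
        unfolding real_norm_def abs_mult by linarith
    qed
  qed measurable
qed

lemma square_integrable_add:
  assumes "square_integrable f" "square_integrable g"
  shows "square_integrable (\<lambda>t. f t + g t)"
proof -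
  have "integrable (lebesgue_on {0..1}) (\<lambda>t. (f t)\<^sup>2 + 2 * (f t * g t) + (g t)\<^sup>2)"
    using assms square_integrable_mult[OF assms] by (auto simp: square_integrable_def)
  then show ?thesis
    using assms by (auto simp: square_integrable_def power2_sum algebra_simps)
qed

lemma square_integrable_scale:
  "square_integrable f \<Longrightarrow> square_integrable (\<lambda>t. c * f t)"
  by (auto simp: square_integrable_def power_mult_distrib)

lemma square_integrable_imp_integrable:
  "square_integrable f \<Longrightarrow> integrable (lebesgue_on {0..1}) f"
  by (rule finite_measure.square_integrable_imp_integrable)
    (simp_all add: square_integrable_def finite_measure_lebesgue_on)

quotient_type L2 = "real \<Rightarrow> real" / partial:
  "\<lambda>f g. square_integrable f \<and> square_integrable g \<and>
    (AE t in lebesgue_on {0..1}. f t = g t)"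
proof (rule part_equivpI)
  show "\<exists>f. square_integrable f \<and> square_integrable f \<and>
    (AE t in lebesgue_on {0..1}. f t = f t)"
    by (rule exI[of _ "\<lambda>_. 0"]) (auto simp: square_integrable_def)
next
  show "symp (\<lambda>f g. square_integrable f \<and> square_integrable g \<and>
    (AE t in lebesgue_on {0..1}. f t = g t))"
    by (rule sympI) (simp add: eq_commute)
next
  show "transp (\<lambda>f g. square_integrable f \<and> square_integrable g \<and>
    (AE t in lebesgue_on {0..1}. f t = g t))"
  proof (rule transpI, elim conjE, intro conjI)
    fix f g h :: "real \<Rightarrow> real"
    assume "AE t in lebesgue_on {0..1}. f t = g t" "AE t in lebesgue_on {0..1}. g t = h t"
    then show "AE t in lebesgue_on {0..1}. f t = h t" by eventually_elim simp
  qed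
qed

instantiation L2 :: real_inner
begin

lift_definition zero_L2 :: L2 is "\<lambda>_. 0"
  by (auto simp: square_integrable_def)

lift_definition plus_L2 :: "L2 \<Rightarrow> L2 \<Rightarrow> L2" is "\<lambda>f g t. f t + g t"
  by (auto intro: square_integrable_add)

lift_definition uminus_L2 :: "L2 \<Rightarrow> L2" is "\<lambda>f t. - f t"
  using square_integrable_scale[of _ "-1"] by auto

lift_definition scaleR_L2 :: "real \<Rightarrow> L2 \<Rightarrow> L2" is "\<lambda>c f t. c * f t"
  by (auto intro: square_integrable_scale)

lift_definition inner_L2 :: "L2 \<Rightarrow> L2 \<Rightarrow> real" is
  "\<lambda>f g. LINT t|lebesgue_on {0..1}. f t * g t"
proof (elim conjE)
  fix f f' g g' :: "real \<Rightarrow> real"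
  assume "square_integrable f" "square_integrable f'" "square_integrable g" "square_integrable g'"
    and eq: "AE t in lebesgue_on {0..1}. f t = f' t" "AE t in lebesgue_on {0..1}. g t = g' t"
  then have [measurable]: "f \<in> borel_measurable (lebesgue_on {0..1})"
    "f' \<in> borel_measurable (lebesgue_on {0..1})"
    "g \<in> borel_measurable (lebesgue_on {0..1})"
    "g' \<in> borel_measurable (lebesgue_on {0..1})"
    by (auto simp: square_integrable_def)
  have "AE t in lebesgue_on {0..1}. f t * g t = f' t * g' t"
    using eq by eventually_elim simp
  then show "(LINT t|lebesgue_on {0..1}. f t * g t) = (LINT t|lebesgue_on {0..1}. f' t * g' t)"
    by (intro integral_cong_AE) measurable
qed

definition minus_L2 :: "L2 \<Rightarrow> L2 \<Rightarrow> L2" where "x - y = x + (- y)" for x y :: L2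
definition norm_L2 :: "L2 \<Rightarrow> real" where "norm x = sqrt (inner x x)" for x :: L2
definition dist_L2 :: "L2 \<Rightarrow> L2 \<Rightarrow> real" where "dist x y = norm (x - y)" for x y :: L2
definition sgn_L2 :: "L2 \<Rightarrow> L2" where "sgn x = scaleR (inverse (norm x)) x" for x :: L2
definition uniformity_L2 :: "(L2 \<times> L2) filter" where
  "uniformity_L2 = (INF e\<in>{0 <..}. principal {(x, y). dist x y < e})"
definition open_L2 :: "L2 set \<Rightarrow> bool" where
  "open_L2 U = (\<forall>x\<in>U. eventually (\<lambda>(x', y). x' = x \<longrightarrow> y \<in> U) uniformity)"

instance
proof
  fix x y z :: L2 and a b c :: real
  show "x + y + z = x + (y + z)"
    by transfer (simp add: add.assoc square_integrable_add)
  show "x + y = y + x"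
    by transfer (simp add: add.commute square_integrable_add)
  show "0 + x = x" by transfer auto
  show "- x + x = 0" by transfer (auto simp: square_integrable_def)
  show "x - y = x + - y" by (simp add: minus_L2_def)
  show "a *\<^sub>R (x + y) = a *\<^sub>R x + a *\<^sub>R y"
    by transfer (simp add: distrib_left square_integrable_add square_integrable_scale)
  show "(a + b) *\<^sub>R x = a *\<^sub>R x + b *\<^sub>R x"
    by transfer (simp add: distrib_right square_integrable_add square_integrable_scale)
  show "a *\<^sub>R b *\<^sub>R x = (a * b) *\<^sub>R x"
    by transfer (simp add: mult.assoc square_integrable_scale)
  show "1 *\<^sub>R x = x" by transfer auto
  show "inner x y = inner y x" by transfer (simp add: mult.commute)
  show "inner (x + y) z = inner x z + inner y z"
    by transfer (simp add: distrib_right square_integrable_mult)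
  show "inner (c *\<^sub>R x) y = c * inner x y"
    by transfer (simp add: mult.assoc)
  show "0 \<le> inner x x" by transfer (simp add: integral_nonneg_AE)
  show "inner x x = 0 \<longleftrightarrow> x = 0"
  proof transfer
    fix f
    assume "square_integrable f \<and> square_integrable f \<and> (AE t in lebesgue_on {0..1}. f t = f t)"
    then have f: "square_integrable f" by blast
    have "(LINT t|lebesgue_on {0..1}. f t * f t) = 0 \<longleftrightarrow>
        (AE t in lebesgue_on {0..1}. f t * f t = 0)"
      by (rule integral_nonneg_eq_0_iff_AE) (auto intro: square_integrable_mult f)
    moreover have "square_integrable (\<lambda>_. 0)" by (auto simp: square_integrable_def)
    ultimately show "(LINT t|lebesgue_on {0..1}. f t * f t) = 0 \<longleftrightarrow>
        square_integrable f \<and> square_integrable (\<lambda>_. 0) \<and> (AE t in lebesgue_on {0..1}. f t = 0)"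
      using f by simp
  qed
  show "norm x = sqrt (inner x x)" by (simp add: norm_L2_def)
  show "dist x y = norm (x - y)" by (simp add: dist_L2_def)
  show "sgn x = scaleR (inverse (norm x)) x" by (simp add: sgn_L2_def)
  show "(uniformity :: (L2 \<times> L2) filter) = (INF e\<in>{0 <..}. principal {(x, y). dist x y < e})"
    by (simp add: uniformity_L2_def)
  show "open U = (\<forall>x\<in>U. eventually (\<lambda>(x', y). x' = x \<longrightarrow> y \<in> U) uniformity)" for U :: "L2 set"
    by (simp add: open_L2_def)
qed

end

definition represents :: "(real \<Rightarrow> real) \<Rightarrow> L2 \<Rightarrow> bool" where
  "represents f x \<longleftrightarrow> square_integrable f \<and> abs_L2 f = x"

text \<open>A set-valued operator on \<open>X\<close> is identified with its graph, a subset of \<open>X \<times> X\<close>;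
  \<^const>\<open>Domain\<close> and \<^const>\<open>converse\<close> are then its domain and its inverse.\<close>

definition graph_of :: "('a \<Rightarrow> 'a) \<Rightarrow> ('a \<times> 'a) set" where
  "graph_of F = {(x, F x) | x. True}"

definition neg_rel :: "('a::real_inner \<times> 'a) set \<Rightarrow> ('a \<times> 'a) set" where
  "neg_rel A = {(x, - u) | x u. (x, u) \<in> A}"

definition adjoint_rel :: "('a::real_inner \<times> 'a) set \<Rightarrow> ('a \<times> 'a) set" where
  "adjoint_rel A = {(x, u). (u, - x) \<in> A\<^sup>\<bottom>}"

text \<open>The operator \<open>(A - A\<^sup>*)/2\<close>, with domain \<open>dom A \<inter> dom A\<^sup>*\<close>.\<close>

definition skew_part :: "('a::real_inner \<times> 'a) set \<Rightarrow> ('a \<times> 'a) set" where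
  "skew_part A = {(x, (1/2) *\<^sub>R (u - v)) | x u v. (x, u) \<in> A \<and> (x, v) \<in> adjoint_rel A}"

definition linear_operator :: "('a::real_inner \<times> 'a) set \<Rightarrow> bool" where
  "linear_operator A \<longleftrightarrow> subspace A \<and> single_valued A"

definition monotone_rel :: "('a::real_inner \<times> 'a) set \<Rightarrow> bool" where
  "monotone_rel A \<longleftrightarrow> (\<forall>(x, u)\<in>A. \<forall>(y, v)\<in>A. inner (x - y) (u - v) \<ge> 0)"

definition maximal_monotone :: "('a::real_inner \<times> 'a) set \<Rightarrow> bool" where
  "maximal_monotone A \<longleftrightarrow> monotone_rel A \<and> \<not> (\<exists>B. monotone_rel B \<and> A \<subset> B)"

definition skew_rel :: "('a::real_inner \<times> 'a) set \<Rightarrow> bool" where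
  "skew_rel A \<longleftrightarrow> (\<forall>(x, u)\<in>A. inner x u = 0)"

lemma square_integrable_primitive:
  assumes "square_integrable f"
  shows "square_integrable (\<lambda>t. LINT s|lebesgue_on {0..t}. f s)"
proof -
  have int: "integrable (lebesgue_on {0..1}) f"
    using assms by (rule square_integrable_imp_integrable)
  have sub: "integrable (lebesgue_on {0..t}) f" if "t \<le> 1" for t
    by (rule integrable_subinterval[OF int]) (use that in auto)
  have "f integrable_on {0..1}"
    using int by (intro integrable_on_lebesgue_on) auto
  then have "continuous_on {0..1} (\<lambda>t. integral {0..t} f)"
    by (rule indefinite_integral_continuous_1)
  then have cont: "continuous_on {0..1} (\<lambda>t. LINT s|lebesgue_on {0..t}. f s)"
    by (rule continuous_on_eq) (simp add: sub lebesgue_integral_eq_integral)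
  then have "continuous_on {0..1} (\<lambda>t. (LINT s|lebesgue_on {0..t}. f s)\<^sup>2)"
    by (intro continuous_intros)
  with cont show ?thesis
    unfolding square_integrable_def
    by (intro conjI continuous_imp_measurable_on_sets_lebesgue continuous_imp_integrable_real) auto
qed

lift_definition volterra :: "L2 \<Rightarrow> L2" is "\<lambda>f t. LINT s|lebesgue_on {0..t}. f s"
proof (elim conjE, intro conjI)
  fix f g :: "real \<Rightarrow> real"
  assume f: "square_integrable f" and g: "square_integrable g"
    and eq: "AE t in lebesgue_on {0..1}. f t = g t"
  show "square_integrable (\<lambda>t. LINT s|lebesgue_on {0..t}. f s)"
    "square_integrable (\<lambda>t. LINT s|lebesgue_on {0..t}. g s)"
    using f g by (auto intro: square_integrable_primitive)
  have "(LINT s|lebesgue_on {0..t}. f s) = (LINT s|lebesgue_on {0..t}. g s)" if "t \<le> 1" for t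
  proof (rule integral_cong_AE)
    have "integrable (lebesgue_on {0..t}) h" if "square_integrable h" for h
      by (rule integrable_subinterval[OF square_integrable_imp_integrable[OF that]])
        (use \<open>t \<le> 1\<close> in auto)
    then show "f \<in> borel_measurable (lebesgue_on {0..t})" "g \<in> borel_measurable (lebesgue_on {0..t})"
      using f g by auto
    have "AE s in lebesgue. s \<in> {0..1} \<longrightarrow> f s = g s"
      using eq by (subst (asm) AE_restrict_space_iff) auto
    then have "AE s in lebesgue. s \<in> {0..t} \<longrightarrow> f s = g s"
      by eventually_elim (use \<open>t \<le> 1\<close> in auto)
    then show "AE s in lebesgue_on {0..t}. f s = g s"
      by (subst AE_restrict_space_iff) auto
  qed
  then show "AE t in lebesgue_on {0..1}.
      (LINT s|lebesgue_on {0..t}. f s) = (LINT s|lebesgue_on {0..t}. g s)"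
    by (intro AE_I2) auto
qed

text \<open>\<open>D\<close> ranges over the finite families of non-overlapping compact subintervals
  \<open>[c,d]\<close> of \<open>[a,b]\<close>, each encoded by its pair of endpoints.\<close>

definition absolutely_continuous_on :: "real \<Rightarrow> real \<Rightarrow> (real \<Rightarrow> real) \<Rightarrow> bool" where
  "absolutely_continuous_on a b f \<longleftrightarrow>
     (\<forall>\<epsilon>>0. \<exists>\<delta>>0. \<forall>D. finite D \<longrightarrow>
        (\<forall>(c, d)\<in>D. a \<le> c \<and> c \<le> d \<and> d \<le> b) \<longrightarrow>
        disjoint_family_on (\<lambda>(c, d). {c<..<d}) D \<longrightarrow>
        (\<Sum>(c, d)\<in>D. d - c) < \<delta> \<longrightarrow>
        (\<Sum>(c, d)\<in>D. \<bar>f d - f c\<bar>) < \<epsilon>)"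

text \<open>That the a.e. derivative is square-integrable is part of the condition
  \<^term>\<open>represents g y\<close>.\<close>

definition periodic_derivative :: "(L2 \<times> L2) set" where
  "periodic_derivative = {(x, y). \<exists>f g. represents f x \<and> represents g y \<and>
     absolutely_continuous_on 0 1 f \<and> f 0 = f 1 \<and>
     (AE t in lebesgue_on {0..1}. (f has_real_derivative g t) (at t within {0..1}))}"

end

theory Submission
  imports Defs
begin

text \<open>
  Write \<open>1\<close> for the constant function, \<open>V\<close> for the Volterra operator and \<open>\<langle>_, _\<rangle>\<close> for the
  inner product. The theorem is almost entirely a consequence of one identity,
  \<open>V + V\<^sup>* = \<langle>_, 1\<rangle> 1\<close> (\<open>inner_volterra_symmetric_part\<close>), and of the facts that
  \<open>V\<close> is injective and that its range contains no nonzero constant (\<open>volterra_eq_constant\<close>). With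
  them each operator is a restriction of \<open>- S\<^sup>*\<close>, which is differentiation without boundary
  conditions, by a linear condition on the integration constant \<open>c\<close> of the function
  \<open>c 1 + V a\<close> with derivative \<open>a\<close>:
    \<^item> \<open>- S\<^sup>*\<close> consists of all pairs \<open>(c 1 + V a, a)\<close>;
    \<^item> \<open>T\<close> requires \<open>c = 0\<close>, and \<open>- T\<^sup>*\<close> requires \<open>c = - \<langle>a, 1\<rangle>\<close>;
    \<^item> \<open>T\<^sub>1\<close> requires \<open>\<langle>a, 1\<rangle> = 0\<close>;
    \<^item> \<open>T\<^sub>2\<close> requires \<open>c = - \<langle>a, 1\<rangle> / 2\<close>;
    \<^item> \<open>S\<close> requires \<open>c = 0\<close> and \<open>\<langle>a, 1\<rangle> = 0\<close>.

  The inclusions and their strictness can be read off. On such a pair the quadratic form is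
  \<open>\<langle>c 1 + V a, a\<rangle> = \<langle>a, 1\<rangle> (c + \<langle>a, 1\<rangle> / 2)\<close>, which gives skewness of \<open>S\<close>, \<open>T\<^sub>1\<close> and
  \<open>T\<^sub>2\<close>, monotonicity of \<open>T\<close> and \<open>T\<^sup>*\<close>, and the failure of monotonicity for \<open>S\<^sup>*\<close> and
  \<open>- S\<^sup>*\<close>. Maximality of \<open>T\<close> and \<open>T\<^sup>*\<close> holds because they are inverses of monotone linear
  maps defined everywhere (\<open>maximal_monotone_converse_graph\<close>); maximality of \<open>T\<^sub>1\<close>, \<open>T\<^sub>2\<close> and
  their negatives holds because \<open>T\<^sub>1\<close> and \<open>T\<^sub>2\<close> are skew and contain the negatives of their
  adjoints (\<open>maximal_monotone_skew\<close>, \<open>maximal_monotone_neg_rel_skew\<close>). Neither \<open>S\<close> nor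
  \<open>- S\<close> is maximal, since \<open>T\<close> and \<open>T\<^sup>*\<close> extend them.

  Two inputs are analytic. The identity for \<open>V + V\<^sup>*\<close> and the description of \<open>T\<^sub>1\<close> need both
  halves of the fundamental theorem of calculus for absolutely continuous functions: an absolutely
  continuous function is the integral of its almost everywhere derivative
  (\<open>fundamental_theorem_of_calculus_absolutely_continuous\<close>), and the primitive of a
  square-integrable function is absolutely continuous with the expected derivative almost everywhere
  (\<open>absolutely_continuous_on_primitive\<close>, \<open>AE_has_real_derivative_primitive\<close>). The density of
  \<open>dom S\<close> is an approximation by polynomials vanishing at both endpoints
  (\<open>closure_volterra_image_orthogonal_one\<close>).
\<close>

section \<open>The fundamental theorem of calculus for absolutely continuous functions\<close>

text \<open>Sums over a tagged division are indexed by tagged intervals, not by pairs of endpoints,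
  but any finite index set is admissible: degenerate intervals contribute nothing, and nondegenerate
  members of a disjoint family are determined by their endpoints.\<close>

lemma absolutely_continuous_on_indexed:
  assumes "absolutely_continuous_on a b f" "0 < \<epsilon>"
  shows "\<exists>\<delta>>0. \<forall>(I :: 'i set) c d. finite I \<longrightarrow> (\<forall>i\<in>I. a \<le> c i \<and> c i \<le> d i \<and> d i \<le> b) \<longrightarrow>
    disjoint_family_on (\<lambda>i. {c i<..<d i}) I \<longrightarrow> (\<Sum>i\<in>I. d i - c i) < \<delta> \<longrightarrow>
    (\<Sum>i\<in>I. \<bar>f (d i) - f (c i)\<bar>) < \<epsilon>"
proof -
  obtain \<delta> where "0 < \<delta>" and \<delta>: "\<And>D. \<lbrakk>finite D; \<forall>(c, d)\<in>D. a \<le> c \<and> c \<le> d \<and> d \<le> b;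
      disjoint_family_on (\<lambda>(c, d). {c<..<d}) D; (\<Sum>(c, d)\<in>D. d - c) < \<delta>\<rbrakk>
      \<Longrightarrow> (\<Sum>(c, d)\<in>D. \<bar>f d - f c\<bar>) < \<epsilon>"
    using assms unfolding absolutely_continuous_on_def by meson
  show ?thesis
  proof (intro exI[of _ \<delta>] conjI allI impI)
    fix I :: "'i set" and c d
    assume I: "finite I" "\<forall>i\<in>I. a \<le> c i \<and> c i \<le> d i \<and> d i \<le> b"
      and disj: "disjoint_family_on (\<lambda>i. {c i<..<d i}) I" and small: "(\<Sum>i\<in>I. d i - c i) < \<delta>"
    define J where "J = {i \<in> I. c i < d i}"
    have J: "finite J" "J \<subseteq> I" "\<And>i. i \<in> I - J \<Longrightarrow> c i = d i"
      using I by (auto simp: J_def order.order_iff_strict)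
    have inj: "inj_on (\<lambda>i. (c i, d i)) J"
    proof (rule inj_onI)
      fix i j assume ij: "i \<in> J" "j \<in> J" "(c i, d i) = (c j, d j)"
      then have "{c i<..<d i} \<inter> {c j<..<d j} \<noteq> {}"
        using dense[of "c i" "d i"] by (auto simp: J_def)
      with ij J(2) show "i = j"
        using disjoint_family_onD[OF disj, of i j] by auto
    qed
    have "(\<Sum>(c, d)\<in>(\<lambda>i. (c i, d i)) ` J. \<bar>f d - f c\<bar>) < \<epsilon>"
    proof (rule \<delta>)
      show "disjoint_family_on (\<lambda>(c, d). {c<..<d}) ((\<lambda>i. (c i, d i)) ` J)"
        unfolding disjoint_family_on_def
      proof (intro ballI impI)
        fix m n assume mn: "m \<in> (\<lambda>i. (c i, d i)) ` J" "n \<in> (\<lambda>i. (c i, d i)) ` J" "m \<noteq> n"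
        then obtain i j where ij: "i \<in> J" "j \<in> J" "m = (c i, d i)" "n = (c j, d j)" by blast
        with mn have "i \<in> I" "j \<in> I" "i \<noteq> j" using J(2) by auto
        from disjoint_family_onD[OF disj this]
        show "(case m of (c, d) \<Rightarrow> {c<..<d}) \<inter> (case n of (c, d) \<Rightarrow> {c<..<d}) = {}"
          unfolding ij prod.case .
      qed
      have "(\<Sum>i\<in>J. d i - c i) = (\<Sum>i\<in>I. d i - c i)"
        using J I(1) by (intro sum.mono_neutral_left) auto
      with small inj show "(\<Sum>(c, d)\<in>(\<lambda>i. (c i, d i)) ` J. d - c) < \<delta>"
        by (simp add: sum.reindex)
    qed (use I J in auto)
    moreover have "(\<Sum>i\<in>J. \<bar>f (d i) - f (c i)\<bar>) = (\<Sum>i\<in>I. \<bar>f (d i) - f (c i)\<bar>)"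
      using J I(1) by (intro sum.mono_neutral_left) auto
    ultimately show "(\<Sum>i\<in>I. \<bar>f (d i) - f (c i)\<bar>) < \<epsilon>" using inj by (simp add: sum.reindex)
  qed (rule \<open>0 < \<delta>\<close>)
qed

text \<open>The gauge argument for the fundamental theorem, with the null set \<open>N\<close> where the
  derivative fails handled by absolute continuity: enclose \<open>N\<close> in an open set \<open>U\<close> of measure less
  than \<open>\<delta>\<close> and let the gauge force every interval tagged in \<open>N\<close> into \<open>U\<close>. Those intervals then
  have total length below \<open>\<delta>\<close>, so \<open>f\<close> changes little over all of them together; over the
  other intervals the increment of \<open>f\<close> is close to \<open>g x\<close> times the length, as usual.\<close>

theorem fundamental_theorem_of_calculus_absolutely_continuous:
  fixes f g :: "real \<Rightarrow> real"
  assumes "a \<le> b" and ac: "absolutely_continuous_on a b f"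
    and deriv: "AE t in lebesgue_on {a..b}. (f has_real_derivative g t) (at t within {a..b})"
  shows "(g has_integral f b - f a) {a..b}"
proof -
  have "AE t in lebesgue. t \<in> {a..b} \<longrightarrow> (f has_real_derivative g t) (at t within {a..b})"
    using deriv by (subst (asm) AE_restrict_space_iff) auto
  then obtain N where null: "N \<in> null_sets lebesgue"
    and N: "\<And>t. t \<in> {a..b} - N \<Longrightarrow> (f has_real_derivative g t) (at t within {a..b})"
    unfolding eventually_ae_filter by auto
  define h where "h t = (if t \<in> N then 0 else g t)" for t
  have "(h has_integral f b - f a) {a..b}"
    unfolding has_integral_factor_content_real
  proof (intro allI impI)
    fix e :: real assume "0 < e"
    show "\<exists>\<gamma>. gauge \<gamma> \<and> (\<forall>p. p tagged_division_of {a..b} \<and> \<gamma> fine p \<longrightarrow>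
        norm ((\<Sum>(x, K)\<in>p. measure lborel K *\<^sub>R h x) - (f b - f a)) \<le> e * measure lborel {a..b})"
    proof (cases "a = b")
      case True
      then have "norm ((\<Sum>(x, K)\<in>p. measure lborel K *\<^sub>R h x) - (f b - f a)) \<le> e * measure lborel {a..b}"
        if "p tagged_division_of {a..b}" for p
        using sum_content_null[of a b p h] that by simp
      then show ?thesis
        by (intro exI[of _ "\<lambda>x. ball x 1"]) auto
    next
      case False
      with \<open>a \<le> b\<close> have "a < b" by simp
      define e' where "e' = e / 2"
      have "0 < e'" using \<open>0 < e\<close> by (simp add: e'_def)
      have "\<forall>x. \<exists>d>0. x \<in> {a..b} - N \<longrightarrow>
         (\<forall>y\<in>{a..b}. norm (y - x) < d \<longrightarrow> norm (f y - f x - g x * (y - x)) \<le> e' * norm (y - x))"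
        using N \<open>0 < e'\<close>
        unfolding has_field_derivative_def has_derivative_within_alt by (metis zero_less_one)
      then obtain \<rho> where \<rho>: "\<And>x. 0 < \<rho> x"
        "\<And>x y. \<lbrakk>x \<in> {a..b} - N; y \<in> {a..b}; norm (y - x) < \<rho> x\<rbrakk>
           \<Longrightarrow> norm (f y - f x - g x * (y - x)) \<le> e' * norm (y - x)"
        by metis
      have "0 < e' * (b - a)" using \<open>0 < e'\<close> \<open>a < b\<close> by simp
      obtain \<delta> where "0 < \<delta>" and \<delta>:
        "\<And>(I :: (real \<times> real set) set) c d. \<lbrakk>finite I;
            \<forall>i\<in>I. a \<le> c i \<and> c i \<le> d i \<and> d i \<le> b;
            disjoint_family_on (\<lambda>i. {c i<..<d i}) I; (\<Sum>i\<in>I. d i - c i) < \<delta>\<rbrakk>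
            \<Longrightarrow> (\<Sum>i\<in>I. \<bar>f (d i) - f (c i)\<bar>) < e' * (b - a)"
        using absolutely_continuous_on_indexed[OF ac \<open>0 < e' * (b - a)\<close>, where ?'i = "real \<times> real set"]
        by blast
      obtain U where U: "open U" "N \<subseteq> U" "U - N \<in> lmeasurable" "emeasure lebesgue (U - N) < ennreal \<delta>"
        using sets_lebesgue_outer_open[of N \<delta>] null \<open>0 < \<delta>\<close> by auto
      have "emeasure lebesgue U = emeasure lebesgue (U - N)"
        using null U(1) by (simp add: emeasure_Diff_null_set)
      then have emU: "emeasure lebesgue U < ennreal \<delta>" using U(4) by simp
      then have U': "U \<in> lmeasurable"
        using U(1) by (intro fmeasurableI) (auto intro: order.strict_trans)
      then have measU: "measure lebesgue U < \<delta>"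
        using emU by (simp add: emeasure_eq_measure2 ennreal_less_iff)
      define \<gamma> where "\<gamma> x = (if x \<in> N then U else ball x (\<rho> x))" for x
      have "gauge \<gamma>"
        using U \<rho>(1) by (auto simp: gauge_def \<gamma>_def)
      moreover have "norm ((\<Sum>(x, K)\<in>p. measure lborel K *\<^sub>R h x) - (f b - f a)) \<le> e * measure lborel {a..b}"
        if p: "p tagged_division_of {a..b}" and fine: "\<gamma> fine p" for p
      proof -
        let ?u = "\<lambda>(x::real, K::real set). Inf K" and ?v = "\<lambda>(x::real, K::real set). Sup K"
        let ?q = "{i \<in> p. fst i \<in> N}"
        have "finite p" using p by (rule tagged_division_of_finite)
        have K: "\<exists>u v. K = {u..v} \<and> a \<le> u \<and> u \<le> v \<and> v \<le> b \<and> x \<in> K \<and> Inf K = u \<and> Sup K = v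
            \<and> K \<subseteq> \<gamma> x" if xK: "(x, K) \<in> p" for x K
        proof -
          obtain u v where "K = cbox u v" using tagged_division_ofD(4)[OF p xK] by blast
          moreover have "x \<in> K" "K \<subseteq> {a..b}" using tagged_division_ofD(2,3)[OF p xK] by auto
          moreover have "K \<subseteq> \<gamma> x" using fineD[OF fine xK] .
          ultimately show ?thesis by (intro exI[of _ u] exI[of _ v]) auto
        qed
        have K': "a \<le> ?u i" "?u i \<le> ?v i" "?v i \<le> b" "{?u i..?v i} \<subseteq> \<gamma> (fst i)"
            "snd i = {?u i..?v i}"
          if "i \<in> p" for i
          using K[of "fst i" "snd i"] that by (auto simp: case_prod_unfold)
        have total: "b - a = (\<Sum>i\<in>p. ?v i - ?u i)" "f b - f a = (\<Sum>i\<in>p. f (?v i) - f (?u i))"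
          using additive_tagged_division_1[OF \<open>a \<le> b\<close> p, of "\<lambda>x. x"]
            additive_tagged_division_1[OF \<open>a \<le> b\<close> p, of f] by (simp_all add: case_prod_unfold)
        have disj: "disjoint_family_on (\<lambda>i. {?u i<..<?v i}) ?q"
          unfolding disjoint_family_on_def
        proof (intro ballI impI)
          fix i j assume ij: "i \<in> ?q" "j \<in> ?q" "i \<noteq> j"
          then have "interior (snd i) \<inter> interior (snd j) = {}"
            using tagged_division_ofD(5)[OF p, of "fst i" "snd i" "fst j" "snd j"] by simp
          then show "{?u i<..<?v i} \<inter> {?u j<..<?v j} = {}"
            using K'(5)[of i] K'(5)[of j] ij by (simp add: interior_atLeastAtMost_real)
        qed
        \<comment> \<open>The intervals tagged in the null set are disjoint up to endpoints and lie in \<open>U\<close>.\<close>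
        have "(\<Sum>i\<in>?q. ?v i - ?u i) = (\<Sum>i\<in>?q. measure lebesgue {?u i<..<?v i})"
          by (intro sum.cong refl) (use K'(2) in simp)
        also have "\<dots> = measure lebesgue (\<Union>i\<in>?q. {?u i<..<?v i})"
          using \<open>finite p\<close> disj K'(2)
          by (intro measure_finite_Union[symmetric]) (auto simp: emeasure_lborel_Ioo)
        also have "\<dots> \<le> measure lebesgue U"
        proof (rule measure_mono_fmeasurable[OF _ _ U'])
          show "(\<Union>i\<in>?q. {?u i<..<?v i}) \<subseteq> U"
          proof (rule UN_least)
            fix i assume i: "i \<in> ?q"
            have "{?u i<..<?v i} \<subseteq> {?u i..?v i}" by (rule greaterThanLessThan_subseteq_atLeastAtMost_iff[THEN iffD2]) simp
            also have "\<dots> \<subseteq> U" using K'(4)[of i] i by (simp add: \<gamma>_def)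
            finally show "{?u i<..<?v i} \<subseteq> U" .
          qed
          show "(\<Union>i\<in>?q. {?u i<..<?v i}) \<in> sets lebesgue"
            using \<open>finite p\<close> by (intro sets.finite_UN) auto
        qed
        also have "\<dots> < \<delta>" by (rule measU)
        finally have "(\<Sum>i\<in>?q. \<bar>f (?v i) - f (?u i)\<bar>) < e' * (b - a)"
          using \<open>finite p\<close> disj K'(1-3) by (intro \<delta>) simp_all
        have "norm ((\<Sum>(x, K)\<in>p. measure lborel K *\<^sub>R h x) - (f b - f a))
            = norm (\<Sum>i\<in>p. measure lborel (snd i) *\<^sub>R h (fst i) - (f (?v i) - f (?u i)))"
          unfolding total(2) by (simp add: sum_subtractf case_prod_unfold)
        also have "\<dots> \<le> (\<Sum>i\<in>p. e' * (?v i - ?u i)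
            + (if fst i \<in> N then \<bar>f (?v i) - f (?u i)\<bar> else 0))"
        proof (rule sum_norm_le)
          fix i assume i: "i \<in> p"
          obtain x K where xK: "i = (x, K)" by fastforce
          from K[of x K] i xK obtain u v where uv: "K = {u..v}" "a \<le> u" "u \<le> v" "v \<le> b"
            "x \<in> {u..v}" "Inf K = u" "Sup K = v" "{u..v} \<subseteq> \<gamma> x" by blast
          have "norm (measure lborel K *\<^sub>R h x - (f v - f u))
            \<le> e' * (v - u) + (if x \<in> N then \<bar>f v - f u\<bar> else 0)"
          proof (cases "x \<in> N")
            case True
            moreover have "0 \<le> e' * (v - u)" using uv \<open>0 < e'\<close> by simp
            ultimately show ?thesis using uv by (simp add: h_def abs_minus_commute)
          next
            case False
            then have "{u..v} \<subseteq> ball x (\<rho> x)" using uv(8) by (simp add: \<gamma>_def)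
            then have "u \<in> ball x (\<rho> x)" "v \<in> ball x (\<rho> x)"
              using uv(3) by (auto intro: subsetD)
            then have "norm (u - x) < \<rho> x" "norm (v - x) < \<rho> x"
              by (simp_all add: dist_norm norm_minus_commute)
            then have "norm (f u - f x - g x * (u - x)) \<le> e' * norm (u - x)"
              "norm (f v - f x - g x * (v - x)) \<le> e' * norm (v - x)"
              using False uv(2-5) by (intro \<rho>(2); simp)+
            then have 1: "\<bar>f u - f x - g x * (u - x)\<bar> \<le> e' * (x - u)"
              "\<bar>f v - f x - g x * (v - x)\<bar> \<le> e' * (v - x)"
              using uv by auto
            have "(v - u) * g x - (f v - f u)
                = (f u - f x - g x * (u - x)) - (f v - f x - g x * (v - x))"
              by (simp add: algebra_simps)
            then have "\<bar>(v - u) * g x - (f v - f u)\<bar> \<le> e' * (x - u) + e' * (v - x)"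
              using 1 by linarith
            also have "\<dots> = e' * (v - u)" by (simp add: algebra_simps)
            finally show ?thesis
              using False uv by (simp add: h_def)
          qed
          then show "norm (measure lborel (snd i) *\<^sub>R h (fst i) - (f (?v i) - f (?u i)))
            \<le> e' * (?v i - ?u i) + (if fst i \<in> N then \<bar>f (?v i) - f (?u i)\<bar> else 0)"
            unfolding xK prod.sel prod.case uv(6,7) .
        qed
        also have "\<dots> = e' * (b - a) + (\<Sum>i\<in>?q. \<bar>f (?v i) - f (?u i)\<bar>)"
          unfolding total(1) sum.distrib sum_distrib_left sum.inter_filter[OF \<open>finite p\<close>] ..
        also have "\<dots> \<le> e' * (b - a) + e' * (b - a)"
          using \<open>(\<Sum>i\<in>?q. \<bar>f (?v i) - f (?u i)\<bar>) < e' * (b - a)\<close> by simp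
        also have "\<dots> = e * measure lborel {a..b}"
          using \<open>a < b\<close> unfolding e'_def by (simp add: content_real)
        finally show ?thesis .
      qed
      ultimately show ?thesis by (intro exI[of _ \<gamma>] conjI allI impI) auto
    qed
  qed
  moreover have "negligible N" using null by (simp add: negligible_iff_null_sets)
  ultimately show ?thesis
    by (rule has_integral_spike[rotated 2]) (simp add: h_def)
qed

section \<open>Primitives of square-integrable functions\<close>

lemma integral_initial_segment:
  fixes f :: "real \<Rightarrow> real"
  assumes "t \<le> 1"
  shows "(LINT s|lebesgue_on {0..t}. f s) = (LINT s|lebesgue_on {0..1}. indicator {0..t} s * f s)"
proof -
  have 1: "indicator {0..t} s *\<^sub>R f s = indicator {0..1} s *\<^sub>R (indicator {0..t} s * f s)" for s
    using assms order_trans[of s t 1] by (auto simp: indicator_def)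
  have 2: "(LINT s|lebesgue_on {0..t}. f s) = (LINT s|lebesgue. indicator {0..t} s *\<^sub>R f s)"
    by (rule integral_restrict_space) simp
  have 3: "(LINT s|lebesgue_on {0..1}. indicator {0..t} s * f s)
      = (LINT s|lebesgue. indicator {0..1} s *\<^sub>R (indicator {0..t} s * f s))"
    by (rule integral_restrict_space) simp
  show ?thesis unfolding 2 3 1 by (rule refl)
qed

lemma integrable_indicator_times:
  fixes f :: "real \<Rightarrow> real"
  assumes "integrable (lebesgue_on {0..1}) f" "A \<in> sets borel"
  shows "integrable (lebesgue_on {0..1}) (\<lambda>s. indicator A s * f s)"
proof -
  have "A \<inter> {0..1} \<in> sets (lebesgue_on {0..1})"
    using assms(2) by (simp add: sets_restrict_space_iff)
  then have "integrable (lebesgue_on {0..1}) (\<lambda>s. indicator (A \<inter> {0..1}) s *\<^sub>R f s)"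
    using assms(1) by (rule integrable_mult_indicator)
  then show ?thesis
    by (rule Bochner_Integration.integrable_cong[THEN iffD1, rotated 2]) (auto simp: indicator_def)
qed

lemma primitive_diff:
  fixes f :: "real \<Rightarrow> real"
  assumes f: "integrable (lebesgue_on {0..1}) f" and cd: "0 \<le> c" "c \<le> d" "d \<le> 1"
  shows "(LINT s|lebesgue_on {0..d}. f s) - (LINT s|lebesgue_on {0..c}. f s)
    = (LINT s|lebesgue_on {0..1}. indicator {c<..d} s * f s)"
proof -
  have "(LINT s|lebesgue_on {0..d}. f s) - (LINT s|lebesgue_on {0..c}. f s)
    = (LINT s|lebesgue_on {0..1}. indicator {0..d} s * f s - indicator {0..c} s * f s)"
    using cd f by (simp add: integral_initial_segment[of d] integral_initial_segment[of c]
        integrable_indicator_times Bochner_Integration.integral_diff)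
  also have "\<dots> = (LINT s|lebesgue_on {0..1}. indicator {c<..d} s * f s)"
    using cd by (intro Bochner_Integration.integral_cong) (auto simp: indicator_def)
  finally show ?thesis .
qed

lemma primitive_0: "(LINT s|lebesgue_on {0::real}. f s) = (0::real)"
proof -
  have "AE s in lebesgue. s \<notin> {0::real}"
    by (rule AE_not_in) simp
  then have "AE s in lebesgue. s \<in> {0::real} \<longrightarrow> f s = 0"
    by eventually_elim simp
  then have "AE s in lebesgue_on {0::real}. f s = 0"
    by (subst AE_restrict_space_iff) auto
  then show ?thesis by (rule integral_eq_zero_AE)
qed

text \<open>For square-integrable \<open>f\<close> Young's inequality
  \<open>\<bar>f\<bar> \<le> \<eta> / 2 * f\<^sup>2 + 1 / (2 * \<eta>)\<close> suffices. Summed over disjoint intervals, the first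
  term contributes at most \<open>\<eta> / 2\<close> times the integral of \<open>f\<^sup>2\<close> over \<open>[0,1]\<close>, and the second
  one the total length divided by \<open>2 * \<eta>\<close>.\<close>

lemma absolutely_continuous_on_primitive:
  assumes f: "square_integrable f"
  shows "absolutely_continuous_on 0 1 (\<lambda>t. LINT s|lebesgue_on {0..t}. f s)"
  unfolding absolutely_continuous_on_def
proof (intro allI impI)
  fix \<epsilon> :: real assume "0 < \<epsilon>"
  let ?M = "lebesgue_on {0..1::real}"
  have int: "integrable ?M f" and int2: "integrable ?M (\<lambda>s. (f s)\<^sup>2)"
    using square_integrable_imp_integrable[OF f] f unfolding square_integrable_def by blast+
  define C where "C = (LINT s|?M. (f s)\<^sup>2) + 1"
  have "0 < C" unfolding C_def by (intro add_nonneg_pos integral_nonneg_AE) auto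
  define \<eta> where "\<eta> = \<epsilon> / C"
  have "0 < \<eta>" using \<open>0 < \<epsilon>\<close> \<open>0 < C\<close> by (simp add: \<eta>_def)
  have young: "\<bar>y\<bar> \<le> \<eta> / 2 * y\<^sup>2 + 1 / (2 * \<eta>)" for y :: real
  proof -
    have "0 \<le> (\<eta> * \<bar>y\<bar> - 1)\<^sup>2 / (2 * \<eta>)" using \<open>0 < \<eta>\<close> by simp
    also have "\<dots> = \<eta> / 2 * y\<^sup>2 + 1 / (2 * \<eta>) - \<bar>y\<bar>"
      using \<open>0 < \<eta>\<close> by (simp add: power2_diff power_mult_distrib field_simps) (simp add: power2_eq_square)
    finally show ?thesis by simp
  qed
  show "\<exists>\<delta>>0. \<forall>D. finite D \<longrightarrow> (\<forall>(c, d)\<in>D. 0 \<le> c \<and> c \<le> d \<and> d \<le> 1) \<longrightarrow>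
      disjoint_family_on (\<lambda>(c, d). {c<..<d}) D \<longrightarrow> (\<Sum>(c, d)\<in>D. d - c) < \<delta> \<longrightarrow>
      (\<Sum>(c, d)\<in>D. \<bar>(LINT s|lebesgue_on {0..d}. f s) - (LINT s|lebesgue_on {0..c}. f s)\<bar>) < \<epsilon>"
  proof (intro exI[of _ "\<epsilon> * \<eta>"] conjI allI impI)
    show "0 < \<epsilon> * \<eta>" using \<open>0 < \<epsilon>\<close> \<open>0 < \<eta>\<close> by simp
    fix D :: "(real \<times> real) set"
    assume "finite D" and D: "\<forall>(c, d)\<in>D. 0 \<le> c \<and> c \<le> d \<and> d \<le> 1"
      and disj: "disjoint_family_on (\<lambda>(c, d). {c<..<d}) D"
      and small: "(\<Sum>(c, d)\<in>D. d - c) < \<epsilon> * \<eta>"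
    let ?J = "\<lambda>i :: real \<times> real. {fst i<..snd i}"
    have D': "0 \<le> fst i \<and> fst i \<le> snd i \<and> snd i \<le> 1" if "i \<in> D" for i
      using D that by auto
    \<comment> \<open>Half-open intervals are disjoint as soon as their interiors are, and unlike open ones they express increments of the primitive without discarding endpoints.\<close>
    have disj': "disjoint_family_on ?J D"
      unfolding disjoint_family_on_def
    proof (intro ballI impI)
      fix i j assume ij: "i \<in> D" "j \<in> D" "i \<noteq> j"
      have "{fst i<..<snd i} \<inter> {fst j<..<snd j} = {}"
        using disjoint_family_onD[OF disj ij] by (simp add: case_prod_unfold)
      then have "min (snd i) (snd j) \<le> max (fst i) (fst j)"
        by simp
      then show "?J i \<inter> ?J j = {}" by auto
    qed
    have meas: "measure ?M (?J i) = snd i - fst i" if "i \<in> D" for i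
      using D'[OF that] by (subst measure_restrict_space) auto
    have sum_ind: "(\<Sum>i\<in>D. indicator (?J i) s) \<le> (1::real)" for s
    proof -
      have "(\<Sum>i\<in>D. indicator (?J i) s :: real) = indicator (\<Union>i\<in>D. ?J i) s"
        using \<open>finite D\<close> disj' by (intro indicator_UN_disjoint[symmetric])
      then show ?thesis by (simp add: indicator_def)
    qed
    have "\<bar>(LINT s|lebesgue_on {0..snd i}. f s) - (LINT s|lebesgue_on {0..fst i}. f s)\<bar>
        \<le> \<eta> / 2 * (LINT s|?M. indicator (?J i) s * (f s)\<^sup>2) + (snd i - fst i) / (2 * \<eta>)"
      if "i \<in> D" for i
    proof -
      have "\<bar>(LINT s|lebesgue_on {0..snd i}. f s) - (LINT s|lebesgue_on {0..fst i}. f s)\<bar>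
        \<le> (LINT s|?M. \<bar>indicator (?J i) s * f s\<bar>)"
        using primitive_diff[OF int, of "fst i" "snd i"] D'[OF that] by simp
      also have "\<dots> \<le> (LINT s|?M. \<eta> / 2 * (indicator (?J i) s * (f s)\<^sup>2)
          + 1 / (2 * \<eta>) * (indicator (?J i) s * 1))"
      proof (rule integral_mono)
        fix s
        show "\<bar>indicator (?J i) s * f s\<bar>
          \<le> \<eta> / 2 * (indicator (?J i) s * (f s)\<^sup>2) + 1 / (2 * \<eta>) * (indicator (?J i) s * 1)"
          using young[of "f s"] by (simp add: indicator_def)
      qed (intro integrable_abs Bochner_Integration.integrable_add integrable_mult_right
          integrable_indicator_times int int2; simp)+
      also have "\<dots> = (LINT s|?M. \<eta> / 2 * (indicator (?J i) s * (f s)\<^sup>2))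
          + (LINT s|?M. 1 / (2 * \<eta>) * (indicator (?J i) s * 1))"
        by (intro Bochner_Integration.integral_add integrable_mult_right integrable_indicator_times int2)
          (simp_all add: finite_measure.integrable_const finite_measure_lebesgue_on)
      also have "\<dots> = \<eta> / 2 * (LINT s|?M. indicator (?J i) s * (f s)\<^sup>2) + 1 / (2 * \<eta>) * (LINT s|?M. indicator (?J i) s * 1)"
        by (simp only: integral_mult_right_zero)
      also have "(LINT s|?M. indicator (?J i) s * 1) = snd i - fst i"
      proof -
        have "?J i \<subseteq> {0..1}" using D'[OF that] by auto
        then show ?thesis using meas[OF that] by (simp add: Int_absorb2)
      qed
      finally show ?thesis by simp
    qed
    then have "(\<Sum>(c, d)\<in>D. \<bar>(LINT s|lebesgue_on {0..d}. f s) - (LINT s|lebesgue_on {0..c}. f s)\<bar>)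
      \<le> (\<Sum>i\<in>D. \<eta> / 2 * (LINT s|?M. indicator (?J i) s * (f s)\<^sup>2) + (snd i - fst i) / (2 * \<eta>))"
      unfolding case_prod_unfold by (rule sum_mono)
    also have "\<dots> = \<eta> / 2 * (\<Sum>i\<in>D. LINT s|?M. indicator (?J i) s * (f s)\<^sup>2) + (\<Sum>i\<in>D. snd i - fst i) / (2 * \<eta>)"
      by (simp add: sum.distrib sum_distrib_left sum_divide_distrib)
    also have "(\<Sum>i\<in>D. LINT s|?M. indicator (?J i) s * (f s)\<^sup>2)
        = (LINT s|?M. (\<Sum>i\<in>D. indicator (?J i) s) * (f s)\<^sup>2)"
      unfolding sum_distrib_right
      by (rule Bochner_Integration.integral_sum[symmetric]) (intro integrable_indicator_times int2, simp)
    also have "\<dots> \<le> (LINT s|?M. (f s)\<^sup>2)"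
    proof (rule integral_mono)
      show "integrable ?M (\<lambda>s. (\<Sum>i\<in>D. indicator (?J i) s) * (f s)\<^sup>2)"
        unfolding sum_distrib_right by (intro Bochner_Integration.integrable_sum integrable_indicator_times int2) simp
      show "(\<Sum>i\<in>D. indicator (?J i) s) * (f s)\<^sup>2 \<le> (f s)\<^sup>2" for s
        using mult_right_mono[OF sum_ind, of "(f s)\<^sup>2" s] by simp
    qed (rule int2)
    also have "\<dots> \<le> C" by (simp add: C_def)
    also have "\<eta> / 2 * C = \<epsilon> / 2" using \<open>0 < C\<close> by (simp add: \<eta>_def)
    also have "(\<Sum>i\<in>D. snd i - fst i) / (2 * \<eta>) < \<epsilon> / 2"
      using small \<open>0 < \<eta>\<close> by (simp add: case_prod_unfold field_simps)
    finally show "(\<Sum>(c, d)\<in>D. \<bar>(LINT s|lebesgue_on {0..d}. f s) - (LINT s|lebesgue_on {0..c}. f s)\<bar>) < \<epsilon>"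
      using \<open>0 < \<eta>\<close> by simp
  qed
qed

lemma absolutely_continuous_on_power2:
  assumes ac: "absolutely_continuous_on a b f" and B: "\<And>t. t \<in> {a..b} \<Longrightarrow> \<bar>f t\<bar> \<le> B"
  shows "absolutely_continuous_on a b (\<lambda>t. (f t)\<^sup>2)"
  unfolding absolutely_continuous_on_def
proof (intro allI impI)
  fix \<epsilon> :: real assume "0 < \<epsilon>"
  define C where "C = 2 * \<bar>B\<bar> + 1"
  have "0 < C" by (simp add: C_def)
  then have "0 < \<epsilon> / C" using \<open>0 < \<epsilon>\<close> by simp
  then obtain \<delta> where "0 < \<delta>" and \<delta>: "\<And>D. finite D \<Longrightarrow> \<forall>(c, d)\<in>D. a \<le> c \<and> c \<le> d \<and> d \<le> b \<Longrightarrow>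
      disjoint_family_on (\<lambda>(c, d). {c<..<d}) D \<Longrightarrow> (\<Sum>(c, d)\<in>D. d - c) < \<delta> \<Longrightarrow>
      (\<Sum>(c, d)\<in>D. \<bar>f d - f c\<bar>) < \<epsilon> / C"
    using ac unfolding absolutely_continuous_on_def by meson
  show "\<exists>\<delta>>0. \<forall>D. finite D \<longrightarrow> (\<forall>(c, d)\<in>D. a \<le> c \<and> c \<le> d \<and> d \<le> b) \<longrightarrow>
      disjoint_family_on (\<lambda>(c, d). {c<..<d}) D \<longrightarrow> (\<Sum>(c, d)\<in>D. d - c) < \<delta> \<longrightarrow>
      (\<Sum>(c, d)\<in>D. \<bar>(f d)\<^sup>2 - (f c)\<^sup>2\<bar>) < \<epsilon>"
  proof (intro exI[of _ \<delta>] conjI allI impI)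
    fix D assume D: "finite D" "\<forall>(c, d)\<in>D. a \<le> c \<and> c \<le> d \<and> d \<le> b"
      "disjoint_family_on (\<lambda>(c, d). {c<..<d}) D" "(\<Sum>(c, d)\<in>D. d - c) < \<delta>"
    have "\<bar>(f d)\<^sup>2 - (f c)\<^sup>2\<bar> \<le> C * \<bar>f d - f c\<bar>" if "(c, d) \<in> D" for c d
    proof -
      have "c \<in> {a..b}" "d \<in> {a..b}" using D(2) that by auto
      then have "\<bar>f d + f c\<bar> \<le> C"
        using B[of c] B[of d] unfolding C_def by linarith
      then have "\<bar>f d + f c\<bar> * \<bar>f d - f c\<bar> \<le> C * \<bar>f d - f c\<bar>"
        by (rule mult_right_mono) simp
      then show ?thesis by (simp add: abs_mult[symmetric] power2_eq_square algebra_simps)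
    qed
    then have "(\<Sum>(c, d)\<in>D. \<bar>(f d)\<^sup>2 - (f c)\<^sup>2\<bar>) \<le> (\<Sum>(c, d)\<in>D. C * \<bar>f d - f c\<bar>)"
      by (intro sum_mono) auto
    also have "\<dots> = C * (\<Sum>(c, d)\<in>D. \<bar>f d - f c\<bar>)"
      by (simp add: sum_distrib_left case_prod_unfold)
    also have "\<dots> < C * (\<epsilon> / C)"
      using \<delta>[OF D] \<open>0 < C\<close> by (intro mult_strict_left_mono)
    finally show "(\<Sum>(c, d)\<in>D. \<bar>(f d)\<^sup>2 - (f c)\<^sup>2\<bar>) < \<epsilon>"
      using \<open>0 < C\<close> by simp
  qed (rule \<open>0 < \<delta>\<close>)
qed

lemma absolutely_continuous_on_add_const:
  "absolutely_continuous_on a b (\<lambda>t. k + f t) \<longleftrightarrow> absolutely_continuous_on a b f"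
  by (simp add: absolutely_continuous_on_def)

lemma absolutely_continuous_on_subinterval:
  assumes "absolutely_continuous_on a b f" "a \<le> a'" "b' \<le> b"
  shows "absolutely_continuous_on a' b' f"
  unfolding absolutely_continuous_on_def
proof (intro allI impI)
  fix \<epsilon> :: real assume "0 < \<epsilon>"
  with assms(1) obtain \<delta> where "0 < \<delta>" and \<delta>: "\<And>D. finite D \<Longrightarrow> \<forall>(c, d)\<in>D. a \<le> c \<and> c \<le> d \<and> d \<le> b \<Longrightarrow>
      disjoint_family_on (\<lambda>(c, d). {c<..<d}) D \<Longrightarrow> (\<Sum>(c, d)\<in>D. d - c) < \<delta> \<Longrightarrow>
      (\<Sum>(c, d)\<in>D. \<bar>f d - f c\<bar>) < \<epsilon>"
    unfolding absolutely_continuous_on_def by meson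
  show "\<exists>\<delta>>0. \<forall>D. finite D \<longrightarrow> (\<forall>(c, d)\<in>D. a' \<le> c \<and> c \<le> d \<and> d \<le> b') \<longrightarrow>
      disjoint_family_on (\<lambda>(c, d). {c<..<d}) D \<longrightarrow> (\<Sum>(c, d)\<in>D. d - c) < \<delta> \<longrightarrow>
      (\<Sum>(c, d)\<in>D. \<bar>f d - f c\<bar>) < \<epsilon>"
  proof (intro exI[of _ \<delta>] conjI allI impI)
    fix D assume D: "finite D" "\<forall>(c, d)\<in>D. a' \<le> c \<and> c \<le> d \<and> d \<le> b'"
      "disjoint_family_on (\<lambda>(c, d). {c<..<d}) D" "(\<Sum>(c, d)\<in>D. d - c) < \<delta>"
    have "\<forall>(c, d)\<in>D. a \<le> c \<and> c \<le> d \<and> d \<le> b"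
      using D(2) assms(2,3) by fastforce
    then show "(\<Sum>(c, d)\<in>D. \<bar>f d - f c\<bar>) < \<epsilon>"
      using D by (intro \<delta>)
  qed (rule \<open>0 < \<delta>\<close>)
qed

text \<open>Lebesgue differentiation of an indefinite integral. The proposition
  \<open>integrable_ccontinuous_explicit\<close> gives right derivatives almost everywhere; applied to the
  reflected function \<open>\<lambda>t. g (- t)\<close> it gives left derivatives as well.\<close>

lemma AE_has_real_derivative_primitive:
  fixes f :: "real \<Rightarrow> real"
  assumes f: "integrable (lebesgue_on {0..1}) f"
  shows "AE t in lebesgue_on {0..1}.
    ((\<lambda>t. LINT s|lebesgue_on {0..t}. f s) has_real_derivative f t) (at t within {0..1})"
proof -
  define g where "g t = (if t \<in> {0..1} then f t else 0)" for t
  have "f integrable_on {0..1}"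
    using f by (intro integrable_on_lebesgue_on) auto
  then have gU: "g integrable_on UNIV"
    unfolding g_def by (rule iffD2[OF Henstock_Kurzweil_Integration.integrable_restrict_UNIV])
  then have g: "g integrable_on cbox a b" for a b
    by (rule integrable_on_subcbox) simp
  then have g': "(\<lambda>t. g (- t)) integrable_on cbox a b" for a b
    using Henstock_Kurzweil_Integration.integrable_reflect_real[where f = g and a = "-b" and b = "-a"] g[of "-b" "-a"] by simp
  obtain N where N: "negligible N" "\<And>x e. \<lbrakk>x \<notin> N; 0 < e\<rbrakk> \<Longrightarrow>
      \<exists>d>0. \<forall>h. 0 < h \<and> h < d \<longrightarrow> norm (integral (cbox x (x + h *\<^sub>R One)) g /\<^sub>R h ^ DIM(real) - g x) < e"
    using integrable_ccontinuous_explicit[of g] g by blast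
  obtain N' where N': "negligible N'" "\<And>x e. \<lbrakk>x \<notin> N'; 0 < e\<rbrakk> \<Longrightarrow>
      \<exists>d>0. \<forall>h. 0 < h \<and> h < d \<longrightarrow> norm (integral (cbox x (x + h *\<^sub>R One)) (\<lambda>t. g (- t)) /\<^sub>R h ^ DIM(real) - g (- x)) < e"
    using integrable_ccontinuous_explicit[of "\<lambda>t. g (- t)"] g' by blast
  have "negligible (uminus ` N')"
    by (rule negligible_differentiable_image_negligible[OF _ N'(1)]) (auto intro!: derivative_intros)
  with N(1) have "negligible (N \<union> uminus ` N')" by simp
  then have null: "N \<union> uminus ` N' \<in> null_sets lebesgue"
    by (simp only: negligible_iff_null_sets)
  have deriv: "((\<lambda>t. LINT s|lebesgue_on {0..t}. f s) has_real_derivative f x) (at x within {0..1})"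
    if x: "x \<in> {0..1}" "x \<notin> N \<union> uminus ` N'" for x
  proof -
    let ?F = "\<lambda>t. LINT s|lebesgue_on {0..t}. f s"
    have F: "?F v - ?F u = integral {u..v} g" if "0 \<le> u" "u \<le> v" "v \<le> 1" for u v
    proof -
      have F_eq: "?F t = integral {0..t} g" if "t \<le> 1" for t
      proof -
        have "integrable (lebesgue_on {0..t}) f"
          by (rule integrable_subinterval[OF f]) (use that in auto)
        then have "?F t = integral {0..t} f" by (simp add: lebesgue_integral_eq_integral)
        also have "\<dots> = integral {0..t} g"
          by (rule Henstock_Kurzweil_Integration.integral_cong) (use that in \<open>auto simp: g_def\<close>)
        finally show ?thesis .
      qed
      have "integral {0..u} g + integral {u..v} g = integral {0..v} g"
        using that g[of 0 v] by (intro Henstock_Kurzweil_Integration.integral_combine) auto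
      with that show ?thesis by (simp add: F_eq)
    qed
    show ?thesis
      unfolding has_field_derivative_def has_derivative_within_alt
    proof (intro conjI allI impI)
      show "bounded_linear ((*) (f x))" by (rule bounded_linear_mult_right)
      fix e :: real assume "0 < e"
      obtain d where "0 < d" and d: "\<And>h. \<lbrakk>0 < h; h < d\<rbrakk> \<Longrightarrow> \<bar>integral {x..x + h} g / h - g x\<bar> < e"
        using N(2)[of x e] x(2) \<open>0 < e\<close> by (auto simp: divide_inverse mult.commute)
      have "- x \<notin> N'" using x(2) by force
      then obtain d' where "0 < d'"
        and d': "\<And>h. \<lbrakk>0 < h; h < d'\<rbrakk> \<Longrightarrow> \<bar>integral {- x..- x + h} (\<lambda>t. g (- t)) / h - g x\<bar> < e"
        using N'(2)[of "- x" e] \<open>0 < e\<close> by (auto simp: divide_inverse mult.commute)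
      have gx: "g x = f x" using x(1) by (simp add: g_def)
      show "\<exists>\<delta>>0. \<forall>y\<in>{0..1}. norm (y - x) < \<delta> \<longrightarrow>
          norm (?F y - ?F x - f x * (y - x)) \<le> e * norm (y - x)"
      proof (intro exI[of _ "min d d'"] conjI ballI impI)
        show "0 < min d d'" using \<open>0 < d\<close> \<open>0 < d'\<close> by simp
        fix y assume y: "y \<in> {0..1}" "norm (y - x) < min d d'"
        consider "y = x" | "x < y" | "y < x" by linarith
        then show "norm (?F y - ?F x - f x * (y - x)) \<le> e * norm (y - x)"
        proof cases
          case 2
          then have "\<bar>integral {x..y} g / (y - x) - g x\<bar> < e"
            using d[of "y - x"] y by simp
          then have "\<bar>integral {x..y} g / (y - x) - g x\<bar> * (y - x) \<le> e * (y - x)"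
            using 2 by (intro mult_right_mono) auto
          also have "\<bar>integral {x..y} g / (y - x) - g x\<bar> * (y - x) = \<bar>(integral {x..y} g / (y - x) - g x) * (y - x)\<bar>"
            using 2 by (simp add: abs_mult)
          also have "(integral {x..y} g / (y - x) - g x) * (y - x) = integral {x..y} g - f x * (y - x)"
            using 2 by (simp add: gx field_simps)
          finally show ?thesis using 2 F[of x y] x y by simp
        next
          case 3
          have "integral {- x..- y} (\<lambda>t. g (- t)) = integral {y..x} g"
            by (rule Henstock_Kurzweil_Integration.integral_reflect_real)
          then have "\<bar>integral {y..x} g / (x - y) - g x\<bar> < e"
            using 3 d'[of "x - y"] y by simp
          then have "\<bar>integral {y..x} g / (x - y) - g x\<bar> * (x - y) \<le> e * (x - y)"
            using 3 by (intro mult_right_mono) auto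
          also have "\<bar>integral {y..x} g / (x - y) - g x\<bar> * (x - y) = \<bar>(integral {y..x} g / (x - y) - g x) * (x - y)\<bar>"
            using 3 by (simp add: abs_mult)
          also have "(integral {y..x} g / (x - y) - g x) * (x - y) = integral {y..x} g - f x * (x - y)"
            using 3 by (simp add: gx field_simps)
          finally have "\<bar>(?F x - ?F y) - f x * (x - y)\<bar> \<le> e * (x - y)"
            using 3 F[of y x] x y by simp
          moreover have "?F y - ?F x - f x * (y - x) = - ((?F x - ?F y) - f x * (x - y))"
            by (simp add: algebra_simps)
          ultimately show ?thesis using 3 by (simp only: real_norm_def abs_minus_cancel) simp
        qed simp
      qed
    qed
  qed
  have "AE x in lebesgue. x \<in> {0..1} \<longrightarrow>
      ((\<lambda>t. LINT s|lebesgue_on {0..t}. f s) has_real_derivative f x) (at x within {0..1})"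
    using deriv by (intro AE_I'[OF null]) blast
  then show ?thesis
    by (subst AE_restrict_space_iff) auto
qed

text \<open>The square of the primitive \<open>F\<close> is again absolutely continuous, with derivative
  \<open>2 * F * f\<close> almost everywhere, and \<open>F\<close> vanishes at \<open>0\<close>.\<close>

lemma integral_times_primitive:
  assumes f: "square_integrable f"
  shows "2 * (LINT t|lebesgue_on {0..1}. (LINT s|lebesgue_on {0..t}. f s) * f t)
    = (LINT s|lebesgue_on {0..1}. f s)\<^sup>2"
proof -
  let ?F = "\<lambda>t. LINT s|lebesgue_on {0..t}. f s" and ?B = "LINT s|lebesgue_on {0..1}. \<bar>f s\<bar>"
  have int: "integrable (lebesgue_on {0..1}) f"
    using f by (rule square_integrable_imp_integrable)
  have "\<bar>?F t\<bar> \<le> ?B" if t: "t \<in> {0..1}" for t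
  proof -
    have "\<bar>?F t\<bar> \<le> (LINT s|lebesgue_on {0..1}. \<bar>indicator {0<..t} s * f s\<bar>)"
      using primitive_diff[OF int, of 0 t] t integral_abs_bound[of "lebesgue_on {0..1}" "\<lambda>s. indicator {0<..t} s * f s"]
      by (simp add: primitive_0)
    also have "\<dots> \<le> ?B"
      by (intro integral_mono integrable_abs integrable_indicator_times int) (auto simp: indicator_def)
    finally show ?thesis .
  qed
  then have "absolutely_continuous_on 0 1 (\<lambda>t. (?F t)\<^sup>2)"
    by (intro absolutely_continuous_on_power2 absolutely_continuous_on_primitive f)
  moreover have "AE t in lebesgue_on {0..1}.
      ((\<lambda>t. (?F t)\<^sup>2) has_real_derivative 2 * (?F t * f t)) (at t within {0..1})"
    using AE_has_real_derivative_primitive[OF int]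
    by eventually_elim (auto intro!: derivative_eq_intros)
  ultimately have F2: "((\<lambda>t. 2 * (?F t * f t)) has_integral (?F 1)\<^sup>2 - (?F 0)\<^sup>2) {0..1}"
    by (intro fundamental_theorem_of_calculus_absolutely_continuous) auto
  have "integrable (lebesgue_on {0..1}) (\<lambda>t. 2 * (?F t * f t))"
    by (intro integrable_mult_right square_integrable_mult square_integrable_primitive f)
  then have "integral {0..1} (\<lambda>t. 2 * (?F t * f t)) = (LINT t|lebesgue_on {0..1}. 2 * (?F t * f t))"
    by (simp add: lebesgue_integral_eq_integral)
  then show ?thesis
    using integral_unique[OF F2] by (simp add: primitive_0)
qed

lemma absolutely_continuous_eq_primitive:
  assumes "absolutely_continuous_on 0 1 f" and g: "integrable (lebesgue_on {0..1}) g"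
    and deriv: "AE t in lebesgue_on {0..1}. (f has_real_derivative g t) (at t within {0..1})"
    and t: "t \<in> {0..1}"
  shows "f t = f 0 + (LINT s|lebesgue_on {0..t}. g s)"
proof -
  have "AE s in lebesgue. s \<in> {0..1} \<longrightarrow> (f has_real_derivative g s) (at s within {0..1})"
    using deriv by (subst (asm) AE_restrict_space_iff) auto
  then have "AE s in lebesgue. s \<in> {0..t} \<longrightarrow> (f has_real_derivative g s) (at s within {0..t})"
    by eventually_elim (use t in \<open>auto intro: DERIV_subset\<close>)
  then have "AE s in lebesgue_on {0..t}. (f has_real_derivative g s) (at s within {0..t})"
    by (subst AE_restrict_space_iff) auto
  moreover have "absolutely_continuous_on 0 t f"
    using t by (intro absolutely_continuous_on_subinterval[OF assms(1)]) auto
  ultimately have "(g has_integral f t - f 0) {0..t}"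
    using t by (intro fundamental_theorem_of_calculus_absolutely_continuous) auto
  moreover have "integrable (lebesgue_on {0..t}) g"
    by (rule integrable_subinterval[OF g]) (use t in auto)
  then have "(LINT s|lebesgue_on {0..t}. g s) = integral {0..t} g"
    by (simp add: lebesgue_integral_eq_integral)
  ultimately show ?thesis by (simp add: integral_unique)
qed

section \<open>The Volterra operator on square-integrable functions\<close>

lemma ex_represents: "\<exists>f. represents f x"
  by (induct x rule: L2.abs_induct) (auto simp: represents_def)

lemma represents_eq_iff:
  assumes "represents f x" "represents g y"
  shows "x = y \<longleftrightarrow> (AE t in lebesgue_on {0..1}. f t = g t)"
  using Quotient_rel[OF Quotient_L2, of f g] assms by (auto simp: represents_def)

lemma represents_cong:
  assumes "represents f x" "\<And>t. t \<in> {0..1} \<Longrightarrow> f t = g t"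
  shows "represents g x"
proof -
  have f: "square_integrable f" "abs_L2 f = x" using assms(1) by (auto simp: represents_def)
  have "square_integrable g"
    using f(1) assms(2) measurable_cong[of "lebesgue_on {0..1}" f g borel]
      Bochner_Integration.integrable_cong[of "lebesgue_on {0..1}" "lebesgue_on {0..1}" "\<lambda>t. (f t)\<^sup>2" "\<lambda>t. (g t)\<^sup>2"]
    by (simp add: square_integrable_def)
  moreover from this f have "abs_L2 g = x"
    using represents_eq_iff[of g "abs_L2 g" f x] assms by (auto simp: represents_def intro!: AE_I2)
  ultimately show ?thesis by (simp add: represents_def)
qed

lemma represents_add:
  "represents f x \<Longrightarrow> represents g y \<Longrightarrow> represents (\<lambda>t. f t + g t) (x + y)"
  by (auto simp: represents_def square_integrable_add plus_L2.abs_eq)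

lemma represents_scaleR: "represents f x \<Longrightarrow> represents (\<lambda>t. c * f t) (c *\<^sub>R x)"
  by (auto simp: represents_def square_integrable_scale scaleR_L2.abs_eq)

lemma represents_diff:
  "represents f x \<Longrightarrow> represents g y \<Longrightarrow> represents (\<lambda>t. f t - g t) (x - y)"
  using represents_add[of f x "\<lambda>t. - 1 * g t" "- 1 *\<^sub>R y"] represents_scaleR[of g y "- 1"] by simp

lemma represents_volterra:
  "represents f x \<Longrightarrow> represents (\<lambda>t. LINT s|lebesgue_on {0..t}. f s) (volterra x)"
  by (auto simp: represents_def square_integrable_primitive volterra.abs_eq)

lemma inner_represents:
  "represents f x \<Longrightarrow> represents g y \<Longrightarrow> inner x y = (LINT t|lebesgue_on {0..1}. f t * g t)"
  by (auto simp: represents_def inner_L2.abs_eq)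

lift_definition one_L2 :: L2 is "\<lambda>_. 1"
  by (auto simp: square_integrable_def finite_measure.integrable_const finite_measure_lebesgue_on)

lemma represents_one: "represents (\<lambda>_. 1) one_L2"
  by (auto simp: represents_def one_L2_def square_integrable_def finite_measure.integrable_const
      finite_measure_lebesgue_on)

lemma inner_one:
  "represents f x \<Longrightarrow> inner x one_L2 = (LINT t|lebesgue_on {0..1}. f t)"
  using inner_represents[OF _ represents_one] by simp

lemma inner_one_one [simp]: "inner one_L2 one_L2 = 1"
  using inner_one[OF represents_one] by (simp add: measure_restrict_space)

lemma volterra_add: "volterra (x + y) = volterra x + volterra y"
proof -
  obtain f g where fg: "represents f x" "represents g y" using ex_represents by meson
  then have int: "integrable (lebesgue_on {0..1}) f" "integrable (lebesgue_on {0..1}) g"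
    by (auto simp: represents_def intro: square_integrable_imp_integrable)
  have "represents (\<lambda>t. (LINT s|lebesgue_on {0..t}. f s) + (LINT s|lebesgue_on {0..t}. g s)) (volterra (x + y))"
  proof (rule represents_cong[OF represents_volterra[OF represents_add[OF fg]]])
    fix t :: real assume t: "t \<in> {0..1}"
    have "integrable (lebesgue_on {0..t}) f" "integrable (lebesgue_on {0..t}) g"
      by (rule integrable_subinterval[OF int(1)] integrable_subinterval[OF int(2)]; use t in auto)+
    then show "(LINT s|lebesgue_on {0..t}. f s + g s)
        = (LINT s|lebesgue_on {0..t}. f s) + (LINT s|lebesgue_on {0..t}. g s)" by simp
  qed
  with represents_add[OF represents_volterra[OF fg(1)] represents_volterra[OF fg(2)]]
  show ?thesis by (simp add: represents_def)
qed

lemma volterra_scaleR: "volterra (c *\<^sub>R x) = c *\<^sub>R volterra x"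
proof -
  obtain f where f: "represents f x" using ex_represents by meson
  from represents_volterra[OF represents_scaleR[OF f]] represents_scaleR[OF represents_volterra[OF f]]
  show ?thesis by (simp add: represents_def)
qed

lemma linear_volterra: "linear volterra"
  by (rule linearI) (rule volterra_add volterra_scaleR)+

lemma inner_volterra_self: "2 * inner (volterra x) x = (inner x one_L2)\<^sup>2"
proof -
  obtain f where f: "represents f x" using ex_represents by meson
  then show ?thesis
    using integral_times_primitive[of f]
    by (simp add: inner_represents[OF represents_volterra[OF f] f] inner_one represents_def)
qed

text \<open>The identity on which everything rests: by polarization, \<open>V + V\<^sup>*\<close> is the
  rank-one projection \<open>x \<mapsto> \<langle>x, 1\<rangle> 1\<close>.\<close>

lemma inner_volterra_symmetric_part:
  "inner (volterra x) y + inner x (volterra y) = inner x one_L2 * inner y one_L2"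
  using inner_volterra_self[of "x + y"] inner_volterra_self[of x] inner_volterra_self[of y]
  by (simp add: volterra_add inner_add power2_eq_square algebra_simps inner_commute)

text \<open>A primitive is continuous and vanishes at \<open>0\<close>, so if it is almost everywhere constant it
  vanishes identically, and then so does its derivative. Hence \<open>V\<close> is injective and its range
  contains no nonzero constant.\<close>

lemma volterra_eq_constant:
  assumes "volterra x = c *\<^sub>R one_L2"
  shows "x = 0" "c = 0"
proof -
  obtain f where f: "represents f x" using ex_represents by meson
  let ?F = "\<lambda>t. LINT s|lebesgue_on {0..t}. f s"
  have int: "integrable (lebesgue_on {0..1}) f"
    using f by (auto simp: represents_def intro: square_integrable_imp_integrable)
  have "AE t in lebesgue_on {0..1}. ?F t = c"
    using represents_eq_iff[OF represents_volterra[OF f] represents_scaleR[OF represents_one, of c]] assms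
    by simp
  then have ae: "AE t in lebesgue. t \<in> {0..1} \<longrightarrow> ?F t = c"
    by (subst (asm) AE_restrict_space_iff) auto
  have cont: "continuous_on {0..1} ?F"
  proof -
    have "integrable (lebesgue_on {0..t}) f" if "t \<in> {0..1}" for t
      by (rule integrable_subinterval[OF int]) (use that in auto)
    then have "integral {0..t} f = ?F t" if "t \<in> {0..1}" for t
      using that by (simp add: lebesgue_integral_eq_integral)
    moreover have "continuous_on {0..1} (\<lambda>t. integral {0..t} f)"
      using int by (intro indefinite_integral_continuous_1 integrable_on_lebesgue_on) auto
    ultimately show ?thesis by (blast intro: continuous_on_eq)
  qed
  have F: "?F t = c" if "t \<in> {0..1}" for t
  proof -
    obtain N where N: "N \<in> null_sets lebesgue" "\<And>t. t \<in> {0..1} - N \<Longrightarrow> ?F t = c"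
      using ae unfolding eventually_ae_filter by auto
    have "((\<lambda>t. \<bar>?F t - c\<bar>) has_integral 0) {0..1}"
      by (rule has_integral_negligible[of N]) (use N in \<open>auto simp: negligible_iff_null_sets\<close>)
    then have "\<bar>?F t - c\<bar> = 0"
      using that by (intro has_integral_0_cbox_imp_0[where a = 0 and b = 1])
        (auto intro!: continuous_intros cont)
    then show ?thesis by simp
  qed
  show "c = 0" using F[of 0] by (simp add: primitive_0)
  have "AE t in lebesgue_on {0..1}. t \<in> {0..1::real}"
    by (rule AE_I2) simp
  with AE_has_real_derivative_primitive[OF int] have "AE t in lebesgue_on {0..1}. f t = 0"
  proof eventually_elim
    case (elim t)
    have "(?F has_real_derivative 0) (at t within {0..1})"
      by (rule has_field_derivative_transform_within[where f = "\<lambda>_. c" and d = 1]) (use elim F in auto)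
    moreover have "at t within {0..1} \<noteq> bot"
      using elim(2) islimpt_Icc[of 0 1 t] by (simp add: trivial_limit_within)
    ultimately show ?case
      using elim(1) vector_derivative_unique_within
      unfolding has_real_derivative_iff_has_vector_derivative by blast
  qed
  then show "x = 0"
    using represents_eq_iff[OF f represents_scaleR[OF represents_one, of 0]] by simp
qed

text \<open>By the two halves of the fundamental theorem the absolutely continuous functions with
  derivative \<open>a\<close> are exactly \<open>c + V a\<close>, and the increment of such a function over \<open>[0,1]\<close> is the
  integral of \<open>a\<close>.\<close>

lemma periodic_derivative_eq:
  "periodic_derivative = {(c *\<^sub>R one_L2 + volterra a, a) | c a. inner a one_L2 = 0}"
proof (intro set_eqI iffI; clarsimp)
  fix x y assume "(x, y) \<in> periodic_derivative"
  then obtain f g where fg: "represents f x" "represents g y" "absolutely_continuous_on 0 1 f" "f 0 = f 1"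
    "AE t in lebesgue_on {0..1}. (f has_real_derivative g t) (at t within {0..1})"
    by (auto simp: periodic_derivative_def)
  have int: "integrable (lebesgue_on {0..1}) g"
    using fg by (auto simp: represents_def intro: square_integrable_imp_integrable)
  note f = absolutely_continuous_eq_primitive[OF fg(3) int fg(5)]
  have "represents (\<lambda>t. f 0 * 1 + (LINT s|lebesgue_on {0..t}. g s)) (f 0 *\<^sub>R one_L2 + volterra y)"
    by (intro represents_add represents_scaleR represents_one represents_volterra fg)
  then have "represents f (f 0 *\<^sub>R one_L2 + volterra y)"
    by (rule represents_cong) (simp add: f[symmetric])
  with fg(1) have "x = f 0 *\<^sub>R one_L2 + volterra y" by (simp add: represents_def)
  moreover have "inner y one_L2 = 0"
    using f[of 1] fg(4) by (simp add: inner_one[OF fg(2)])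
  ultimately show "(\<exists>c. x = c *\<^sub>R one_L2 + volterra y) \<and> inner y one_L2 = 0" by blast
next
  fix c a assume a: "inner a one_L2 = 0"
  obtain g where g: "represents g a" using ex_represents by meson
  let ?f = "\<lambda>t. c * 1 + (LINT s|lebesgue_on {0..t}. g s)"
  have sq: "square_integrable g" using g by (simp add: represents_def)
  have "represents ?f (c *\<^sub>R one_L2 + volterra a)"
    by (intro represents_add represents_scaleR represents_one represents_volterra g)
  moreover have "absolutely_continuous_on 0 1 ?f"
    by (simp add: absolutely_continuous_on_add_const absolutely_continuous_on_primitive sq)
  moreover have "?f 0 = ?f 1"
    using a inner_one[OF g] by (simp add: primitive_0)
  moreover have "AE t in lebesgue_on {0..1}. (?f has_real_derivative g t) (at t within {0..1})"
    using AE_has_real_derivative_primitive[OF square_integrable_imp_integrable[OF sq]]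
    by eventually_elim (auto intro!: derivative_eq_intros)
  ultimately show "(c *\<^sub>R one_L2 + volterra a, a) \<in> periodic_derivative"
    using g unfolding periodic_derivative_def by blast
qed

section \<open>Density of the primitives that vanish at both endpoints\<close>

lemma continuous_imp_square_integrable:
  assumes "continuous_on {0..1} f"
  shows "square_integrable f"
  unfolding square_integrable_def
  by (intro conjI continuous_imp_measurable_on_sets_lebesgue continuous_imp_integrable_real
      continuous_intros assms) auto

text \<open>Truncating \<open>f\<close> at height \<open>m\<close> costs little by dominated convergence. A measurable
  function is an almost everywhere limit of continuous functions \<open>G n\<close>; truncating these at the same
  height makes the convergence bounded, so dominated convergence applies a second time.\<close>

lemma square_integrable_approx_continuous:
  assumes f: "square_integrable f" and "0 < \<epsilon>"
  obtains g where "continuous_on {0..1} g" "(LINT t|lebesgue_on {0..1}. (f t - g t)\<^sup>2) < \<epsilon>"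
proof -
  let ?M = "lebesgue_on {0..1::real}"
  interpret finite_measure ?M by (rule finite_measure_lebesgue_on) simp
  have [measurable]: "f \<in> borel_measurable ?M" and f2: "integrable ?M (\<lambda>t. (f t)\<^sup>2)"
    using f by (auto simp: square_integrable_def)
  define cut where "cut m y = max (- real m) (min (real m) y)" for m y
  have cut_cont: "continuous_on A (\<lambda>t. cut m (h t))" if "continuous_on A h" for A m and h :: "real \<Rightarrow> real"
    unfolding cut_def using that by (intro continuous_intros)
  have [measurable]: "cut m \<in> borel_measurable borel" for m
    unfolding cut_def by measurable
  have "(\<lambda>m. LINT t|?M. (f t - cut m (f t))\<^sup>2) \<longlonglongrightarrow> (LINT t|?M. 0)"
  proof (rule integral_dominated_convergence[where w = "\<lambda>t. (f t)\<^sup>2"])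
    show "AE t in ?M. (\<lambda>m. (f t - cut m (f t))\<^sup>2) \<longlonglongrightarrow> 0"
    proof (rule AE_I2, rule tendsto_eventually)
      fix t
      obtain m0 :: nat where "\<bar>f t\<bar> \<le> real m0" using real_arch_simple by blast
      then have "(f t - cut m (f t))\<^sup>2 = 0" if "m0 \<le> m" for m
        using that of_nat_mono[OF that, where 'a = real] by (auto simp: cut_def)
      then show "eventually (\<lambda>m. (f t - cut m (f t))\<^sup>2 = 0) sequentially"
        by (auto simp: eventually_sequentially)
    qed
    show "AE t in ?M. norm ((f t - cut m (f t))\<^sup>2) \<le> (f t)\<^sup>2" for m
    proof (rule AE_I2)
      fix t
      have "\<bar>f t - cut m (f t)\<bar> \<le> \<bar>f t\<bar>" by (auto simp: cut_def)
      then show "norm ((f t - cut m (f t))\<^sup>2) \<le> (f t)\<^sup>2" by (simp add: abs_le_square_iff)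
    qed
  qed (use f2 in measurable)
  then have "(\<lambda>m. LINT t|?M. (f t - cut m (f t))\<^sup>2) \<longlonglongrightarrow> 0" by simp
  then have "eventually (\<lambda>m. (LINT t|?M. (f t - cut m (f t))\<^sup>2) < \<epsilon> / 4) sequentially"
    by (rule order_tendstoD(2)) (use \<open>0 < \<epsilon>\<close> in simp)
  then obtain m where m: "(LINT t|?M. (f t - cut m (f t))\<^sup>2) < \<epsilon> / 4"
    by (auto simp: eventually_sequentially)
  have "f measurable_on {0..1}"
    by (subst measurable_on_iff_borel_measurable) auto
  then obtain N G where N: "negligible N" and G: "\<And>n. continuous_on UNIV (G n)"
    "\<And>t. t \<notin> N \<Longrightarrow> (\<lambda>n. G n t) \<longlonglongrightarrow> (if t \<in> {0..1} then f t else 0)"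
    unfolding measurable_on_def by blast
  have [measurable]: "G n \<in> borel_measurable ?M" for n
    by (intro continuous_imp_measurable_on_sets_lebesgue continuous_on_subset[OF G(1)]) auto
  have "(\<lambda>n. LINT t|?M. (cut m (f t) - cut m (G n t))\<^sup>2) \<longlonglongrightarrow> (LINT t|?M. 0)"
  proof (rule integral_dominated_convergence[where w = "\<lambda>t. (2 * real m)\<^sup>2"])
    have "AE t in lebesgue. t \<notin> N"
      using N by (intro AE_not_in) (simp add: negligible_iff_null_sets)
    then have "AE t in lebesgue. t \<in> {0..1} \<longrightarrow> (\<lambda>n. (cut m (f t) - cut m (G n t))\<^sup>2) \<longlonglongrightarrow> 0"
    proof eventually_elim
      case (elim t)
      show ?case
      proof
        assume "t \<in> {0..1}"
        with G(2)[OF elim] have "(\<lambda>n. G n t) \<longlonglongrightarrow> f t" by simp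
        then have "(\<lambda>n. (cut m (f t) - cut m (G n t))\<^sup>2) \<longlonglongrightarrow> (cut m (f t) - cut m (f t))\<^sup>2"
          unfolding cut_def by (intro tendsto_intros)
        then show "(\<lambda>n. (cut m (f t) - cut m (G n t))\<^sup>2) \<longlonglongrightarrow> 0" by simp
      qed
    qed
    then show "AE t in ?M. (\<lambda>n. (cut m (f t) - cut m (G n t))\<^sup>2) \<longlonglongrightarrow> 0"
      by (subst AE_restrict_space_iff) auto
    show "AE t in ?M. norm ((cut m (f t) - cut m (G n t))\<^sup>2) \<le> (2 * real m)\<^sup>2" for n
    proof (rule AE_I2)
      fix t
      have "\<bar>cut m (f t) - cut m (G n t)\<bar> \<le> \<bar>2 * real m\<bar>" by (auto simp: cut_def)
      then show "norm ((cut m (f t) - cut m (G n t))\<^sup>2) \<le> (2 * real m)\<^sup>2"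
        unfolding abs_le_square_iff by simp
    qed
  qed auto
  then have "(\<lambda>n. LINT t|?M. (cut m (f t) - cut m (G n t))\<^sup>2) \<longlonglongrightarrow> 0" by simp
  then have "eventually (\<lambda>n. (LINT t|?M. (cut m (f t) - cut m (G n t))\<^sup>2) < \<epsilon> / 4) sequentially"
    by (rule order_tendstoD(2)) (use \<open>0 < \<epsilon>\<close> in simp)
  then obtain n where n: "(LINT t|?M. (cut m (f t) - cut m (G n t))\<^sup>2) < \<epsilon> / 4"
    by (auto simp: eventually_sequentially)
  let ?p = "\<lambda>t. cut m (f t)" and ?g = "\<lambda>t. cut m (G n t)"
  have cont: "continuous_on {0..1} ?g"
    by (intro cut_cont continuous_on_subset[OF G(1)]) simp
  have p: "square_integrable ?p"
    unfolding square_integrable_def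
  proof
    show "integrable ?M (\<lambda>t. (?p t)\<^sup>2)"
    proof (rule integrable_const_bound[where B = "(real m)\<^sup>2"])
      show "AE t in ?M. norm ((?p t)\<^sup>2) \<le> (real m)\<^sup>2"
        by (rule AE_I2) (simp add: abs_le_square_iff[symmetric], simp add: cut_def)
    qed measurable
  qed measurable
  note diff = square_integrable_add[OF _ square_integrable_scale[where c = "-1"], simplified]
  have d: "integrable ?M (\<lambda>t. (f t - ?g t)\<^sup>2)" "integrable ?M (\<lambda>t. (f t - ?p t)\<^sup>2)"
      "integrable ?M (\<lambda>t. (?p t - ?g t)\<^sup>2)"
    using diff[OF f continuous_imp_square_integrable[OF cont]] diff[OF f p]
      diff[OF p continuous_imp_square_integrable[OF cont]] by (auto simp: square_integrable_def)
  have "(LINT t|?M. (f t - ?g t)\<^sup>2) \<le> (LINT t|?M. 2 * (f t - ?p t)\<^sup>2 + 2 * (?p t - ?g t)\<^sup>2)"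
  proof (rule integral_mono)
    show "(f t - ?g t)\<^sup>2 \<le> 2 * (f t - ?p t)\<^sup>2 + 2 * (?p t - ?g t)\<^sup>2" for t
    proof -
      have "2 * (f t - ?p t)\<^sup>2 + 2 * (?p t - ?g t)\<^sup>2 - (f t - ?g t)\<^sup>2 = (f t - 2 * ?p t + ?g t)\<^sup>2"
        by (simp add: power2_eq_square algebra_simps)
      then show ?thesis using zero_le_power2[of "f t - 2 * ?p t + ?g t"] by linarith
    qed
  qed (use d in auto)
  also have "\<dots> = 2 * (LINT t|?M. (f t - ?p t)\<^sup>2) + 2 * (LINT t|?M. (?p t - ?g t)\<^sup>2)"
    using d by simp
  also have "\<dots> < \<epsilon>" using m n by simp
  finally show ?thesis using that cont by blast
qed

text \<open>The only Bernstein polynomials of degree \<open>n\<close> that do not vanish at both endpoints are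
  \<open>(1 - t) ^ n\<close> and \<open>t ^ n\<close>. Dropping these two terms changes the pointwise limit only at
  the endpoints and keeps the approximants bounded, so convergence in mean square survives.\<close>

lemma continuous_approx_polynomial_vanishing:
  fixes g :: "real \<Rightarrow> real"
  assumes g: "continuous_on {0..1} g" and "0 < \<epsilon>"
  obtains q where "real_polynomial_function q" "q 0 = 0" "q 1 = 0"
    "(LINT t|lebesgue_on {0..1}. (g t - q t)\<^sup>2) < \<epsilon>"
proof -
  let ?M = "lebesgue_on {0..1::real}"
  interpret finite_measure ?M by (rule finite_measure_lebesgue_on) simp
  define q where "q n t = (\<Sum>k\<in>{0<..<n}. g (k / n) * Bernstein n k t)" for n t
  have poly: "real_polynomial_function (q n)" for n
    unfolding q_def Bernstein_def
    by (intro real_polynomial_function_sum real_polynomial_function.intros real_polynomial_function_power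
        real_polynomial_function_diff bounded_linear_ident) auto
  have q01: "q n 0 = 0" "q n 1 = 0" for n
    unfolding q_def Bernstein_def by (auto intro!: sum.neutral)
  have split: "(\<Sum>k\<le>n. g (k / n) * Bernstein n k t) = g 0 * (1 - t) ^ n + g 1 * t ^ n + q n t"
    if "0 < n" for n t
  proof -
    have "{..n} = insert 0 (insert n {0<..<n})" using that by auto
    then show ?thesis using that by (simp add: q_def Bernstein_def)
  qed
  obtain B where B: "\<And>t. t \<in> {0..1} \<Longrightarrow> \<bar>g t\<bar> \<le> B"
    using compact_imp_bounded[OF compact_continuous_image[OF g compact_Icc]]
    unfolding bounded_iff real_norm_def by blast
  have bound: "\<bar>q n t\<bar> \<le> B" if t: "t \<in> {0..1}" for n t
  proof -
    have "0 \<le> B" using B[of 0] by simp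
    have nonneg: "0 \<le> Bernstein n k t" for k using t by (simp add: Bernstein_nonneg)
    have "\<bar>q n t\<bar> \<le> (\<Sum>k\<in>{0<..<n}. \<bar>g (k / n) * Bernstein n k t\<bar>)"
      unfolding q_def by (rule sum_abs)
    also have "\<dots> \<le> (\<Sum>k\<in>{0<..<n}. B * Bernstein n k t)"
      using nonneg by (intro sum_mono) (auto simp: abs_mult intro!: mult_right_mono B)
    also have "\<dots> \<le> (\<Sum>k\<le>n. B * Bernstein n k t)"
      using nonneg \<open>0 \<le> B\<close> by (intro sum_mono2) auto
    also have "\<dots> = B" by (simp add: sum_distrib_left[symmetric])
    finally show ?thesis .
  qed
  have g_meas: "g \<in> borel_measurable ?M" and q_meas: "q n \<in> borel_measurable ?M" for n
    by (intro continuous_imp_measurable_on_sets_lebesgue g continuous_on_polymonial_function[OF poly[unfolded real_polynomial_function_eq]]; simp)+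
  have "(\<lambda>n. LINT t|?M. (g t - q n t)\<^sup>2) \<longlonglongrightarrow> (LINT t|?M. 0)"
  proof (rule integral_dominated_convergence[where w = "\<lambda>t. (2 * B)\<^sup>2"])
    have "AE t in lebesgue. t \<notin> {0, 1::real}"
      by (rule AE_not_in) simp
    then have "AE t in lebesgue. t \<in> {0..1} \<longrightarrow> (\<lambda>n. (g t - q n t)\<^sup>2) \<longlonglongrightarrow> 0"
    proof eventually_elim
      case (elim t)
      show ?case
      proof
        assume "t \<in> {0..1}"
        with elim have t: "0 < t" "t < 1" by auto
        have "(\<lambda>n. \<Sum>k\<le>n. g (k / n) * Bernstein n k t) \<longlonglongrightarrow> g t"
        proof (rule LIMSEQ_I)
          fix e :: real assume "0 < e"
          from Bernstein_Weierstrass[OF g this]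
          show "\<exists>no. \<forall>n\<ge>no. norm ((\<Sum>k\<le>n. g (k / n) * Bernstein n k t) - g t) < e"
            using t by (simp add: abs_minus_commute) (meson less_imp_le)
        qed
        then have "(\<lambda>n. (\<Sum>k\<le>n. g (k / n) * Bernstein n k t) - g 0 * (1 - t) ^ n - g 1 * t ^ n)
            \<longlonglongrightarrow> g t - g 0 * 0 - g 1 * 0"
          using t by (intro tendsto_intros LIMSEQ_power_zero) auto
        moreover have "eventually (\<lambda>n. (\<Sum>k\<le>n. g (k / n) * Bernstein n k t) - g 0 * (1 - t) ^ n - g 1 * t ^ n
            = q n t) sequentially"
          using eventually_gt_at_top[of 0] by eventually_elim (simp add: split)
        ultimately have "(\<lambda>n. q n t) \<longlonglongrightarrow> g t - g 0 * 0 - g 1 * 0"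
          by (rule Lim_transform_eventually)
        then have "(\<lambda>n. (g t - q n t)\<^sup>2) \<longlonglongrightarrow> (g t - (g t - g 0 * 0 - g 1 * 0))\<^sup>2"
          by (intro tendsto_intros)
        then show "(\<lambda>n. (g t - q n t)\<^sup>2) \<longlonglongrightarrow> 0" by simp
      qed
    qed
    then show "AE t in ?M. (\<lambda>n. (g t - q n t)\<^sup>2) \<longlonglongrightarrow> 0"
      by (subst AE_restrict_space_iff) auto
    show "AE t in ?M. norm ((g t - q n t)\<^sup>2) \<le> (2 * B)\<^sup>2" for n
    proof (rule AE_I2)
      fix t assume "t \<in> space ?M"
      then have t: "t \<in> {0..1}" by simp
      have "\<bar>g t - q n t\<bar> \<le> \<bar>2 * B\<bar>" using B[OF t] bound[OF t, of n] by linarith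
      then show "norm ((g t - q n t)\<^sup>2) \<le> (2 * B)\<^sup>2"
        unfolding abs_le_square_iff by simp
    qed
  qed (use g_meas q_meas in measurable)
  then have "(\<lambda>n. LINT t|?M. (g t - q n t)\<^sup>2) \<longlonglongrightarrow> 0" by simp
  then have "eventually (\<lambda>n. (LINT t|?M. (g t - q n t)\<^sup>2) < \<epsilon>) sequentially"
    by (rule order_tendstoD(2)) (rule \<open>0 < \<epsilon>\<close>)
  then obtain n where "(LINT t|?M. (g t - q n t)\<^sup>2) < \<epsilon>"
    by (auto simp: eventually_sequentially)
  with poly q01 show ?thesis by (rule that)
qed

lemma polynomial_vanishing_in_volterra_image:
  assumes q: "real_polynomial_function q" "q 0 = 0" "q 1 = 0" and x: "represents q x"
  shows "x \<in> volterra ` {a. inner a one_L2 = 0}"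
proof -
  obtain q' where q': "real_polynomial_function q'" "\<And>t. (q has_real_derivative q' t) (at t)"
    using has_real_derivative_polynomial_function[OF q(1)] by blast
  have cont: "continuous_on A q'" for A
    using q'(1) by (simp add: continuous_on_polymonial_function real_polynomial_function_eq)
  then have a: "represents q' (abs_L2 q')"
    by (simp add: represents_def continuous_imp_square_integrable)
  have prim: "(LINT s|lebesgue_on {0..t}. q' s) = q t" if "t \<in> {0..1}" for t
  proof -
    have "integrable (lebesgue_on {0..t}) q'"
      by (intro continuous_imp_integrable_real cont)
    then have "(LINT s|lebesgue_on {0..t}. q' s) = integral {0..t} q'"
      by (simp add: lebesgue_integral_eq_integral)
    also have "(q' has_integral q t - q 0) {0..t}"
      using that q'(2)
      by (intro fundamental_theorem_of_calculus)
        (auto simp: has_real_derivative_iff_has_vector_derivative[symmetric] intro: has_field_derivative_at_within)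
    then have "integral {0..t} q' = q t" using q(2) by (simp add: integral_unique)
    finally show ?thesis .
  qed
  have "represents q (volterra (abs_L2 q'))"
    by (rule represents_cong[OF represents_volterra[OF a]]) (rule prim)
  then have "x = volterra (abs_L2 q')" using x by (simp add: represents_def)
  moreover have "inner (abs_L2 q') one_L2 = 0"
    using prim[of 1] q(3) by (simp add: inner_one[OF a])
  ultimately show ?thesis by blast
qed

text \<open>This is the density of \<open>dom S\<close>. It is shown by explicit approximation: the
  orthogonal complement of the domain is easily seen to be trivial, but density follows from that only in a
  complete space.\<close>

lemma closure_volterra_image_orthogonal_one:
  "closure (volterra ` {a. inner a one_L2 = 0}) = UNIV"
proof (intro set_eqI iffI UNIV_I)
  fix x :: L2
  obtain f where f: "represents f x" using ex_represents by meson
  have dist2: "(dist y z)\<^sup>2 = (LINT t|lebesgue_on {0..1}. (u t - v t)\<^sup>2)"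
    if "represents u y" "represents v z" for u v y z
  proof -
    have "(dist y z)\<^sup>2 = inner (y - z) (y - z)" by (simp add: dist_norm power2_norm_eq_inner)
    with inner_represents[OF represents_diff[OF that] represents_diff[OF that]]
    show ?thesis by (simp add: power2_eq_square)
  qed
  show "x \<in> closure (volterra ` {a. inner a one_L2 = 0})"
    unfolding closure_approachable
  proof (intro allI impI)
    fix e :: real assume "0 < e"
    then have e2: "0 < (e / 2)\<^sup>2" by simp
    obtain g where g: "continuous_on {0..1} g" "(LINT t|lebesgue_on {0..1}. (f t - g t)\<^sup>2) < (e / 2)\<^sup>2"
      using square_integrable_approx_continuous[OF _ e2] f by (auto simp: represents_def)
    obtain q where q: "real_polynomial_function q" "q 0 = 0" "q 1 = 0"
      "(LINT t|lebesgue_on {0..1}. (g t - q t)\<^sup>2) < (e / 2)\<^sup>2"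
      using continuous_approx_polynomial_vanishing[OF g(1) e2] by blast
    have "represents g (abs_L2 g)"
      by (simp add: represents_def continuous_imp_square_integrable g)
    moreover have rq: "represents q (abs_L2 q)"
      using q(1) by (simp add: represents_def continuous_imp_square_integrable
          continuous_on_polymonial_function real_polynomial_function_eq)
    ultimately have d: "(dist x (abs_L2 g))\<^sup>2 < (e / 2)\<^sup>2" "(dist (abs_L2 g) (abs_L2 q))\<^sup>2 < (e / 2)\<^sup>2"
      using dist2 f g(2) q(4) by auto
    have "dist x (abs_L2 g) < e / 2" "dist (abs_L2 g) (abs_L2 q) < e / 2"
      using power2_less_imp_less[OF d(1)] power2_less_imp_less[OF d(2)] \<open>0 < e\<close> by simp_all
    then have "dist (abs_L2 q) x < e"
      using dist_triangle[of x "abs_L2 q" "abs_L2 g"] by (simp add: dist_commute)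
    then show "\<exists>y\<in>volterra ` {a. inner a one_L2 = 0}. dist y x < e"
      using polynomial_vanishing_in_volterra_image[OF q(1-3) rq] by blast
  qed
qed

section \<open>Skew and maximal monotone linear relations\<close>

lemma mem_neg_rel: "(x, u) \<in> neg_rel A \<longleftrightarrow> (x, - u) \<in> A"
  by (force simp: neg_rel_def)

lemma neg_rel_neg_rel [simp]: "neg_rel (neg_rel A) = A"
  by (auto simp: mem_neg_rel)

lemma neg_rel_psubset_iff: "neg_rel A \<subset> neg_rel B \<longleftrightarrow> A \<subset> B"
proof -
  have "neg_rel C \<subseteq> neg_rel D" if "C \<subseteq> D" for C D :: "('a \<times> 'a) set"
    using that by (auto simp: mem_neg_rel)
  from this[of A B] this[of B A] this[of "neg_rel A" "neg_rel B"] this[of "neg_rel B" "neg_rel A"]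
  show ?thesis by auto
qed

lemma skew_rel_neg_rel: "skew_rel A \<Longrightarrow> skew_rel (neg_rel A)"
  by (fastforce simp: skew_rel_def mem_neg_rel)

lemma mem_adjoint_rel: "(x, u) \<in> adjoint_rel A \<longleftrightarrow> (\<forall>(a, b)\<in>A. inner a u = inner b x)"
  by (auto simp: adjoint_rel_def orthogonal_comp_def orthogonal_def inner_commute)

lemma adjoint_rel_converse: "adjoint_rel (A\<inverse>) = (adjoint_rel A)\<inverse>"
  by (auto simp: mem_adjoint_rel; force)

lemma adjoint_rel_antimono: "A \<subseteq> B \<Longrightarrow> adjoint_rel B \<subseteq> adjoint_rel A"
  by (fastforce simp: mem_adjoint_rel)

lemma adjoint_rel_neg_rel: "adjoint_rel (neg_rel A) = neg_rel (adjoint_rel A)"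
proof -
  have "(\<forall>(a, b)\<in>neg_rel A. inner a u = inner b x) \<longleftrightarrow> (\<forall>(a, b)\<in>A. inner a (- u) = inner b x)" for x u
    by (force simp: neg_rel_def minus_equation_iff eq_commute)
  then show ?thesis
    by (auto simp: mem_adjoint_rel mem_neg_rel)
qed

lemma subspace_neg_rel:
  assumes "subspace A"
  shows "subspace (neg_rel A)"
proof (rule subspaceI)
  show "0 \<in> neg_rel A"
    using subspace_0[OF assms] by (simp add: zero_prod_def mem_neg_rel)
  fix p q assume "p \<in> neg_rel A" "q \<in> neg_rel A"
  then show "p + q \<in> neg_rel A"
    using subspace_add[OF assms, of "(fst p, - snd p)" "(fst q, - snd q)"]
    by (cases p, cases q) (simp add: mem_neg_rel)
next
  fix c p assume "p \<in> neg_rel A"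
  then show "c *\<^sub>R p \<in> neg_rel A"
    using subspace_scale[OF assms, of "(fst p, - snd p)" c]
    by (cases p) (simp add: mem_neg_rel)
qed

lemma mem_graph_of: "(x, u) \<in> graph_of F \<longleftrightarrow> u = F x"
  by (auto simp: graph_of_def)

lemma mem_skew_part:
  "(x, w) \<in> skew_part A \<longleftrightarrow> (\<exists>u v. (x, u) \<in> A \<and> (x, v) \<in> adjoint_rel A \<and> w = (1/2) *\<^sub>R (u - v))"
  by (auto simp: skew_part_def)

lemma subspace_converse_graph:
  assumes "linear F"
  shows "subspace ((graph_of F)\<inverse>)"
  by (rule subspaceI)
    (auto simp: mem_graph_of zero_prod_def linear_0[OF assms] linear_add[OF assms] linear_scale[OF assms])

lemma skew_rel_imp_monotone_rel:
  assumes "subspace A" "skew_rel A"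
  shows "monotone_rel A"
  unfolding monotone_rel_def
proof (clarify)
  fix x u y v assume "(x, u) \<in> A" "(y, v) \<in> A"
  then have "(x - y, u - v) \<in> A" using subspace_diff[OF assms(1), of "(x, u)" "(y, v)"] by simp
  then show "0 \<le> inner (x - y) (u - v)" using assms(2) by (auto simp: skew_rel_def)
qed

text \<open>If \<open>(y, v)\<close> is monotonically related to a skew subspace \<open>A\<close>, then for \<open>(x, u) \<in> A\<close>
  and every real \<open>c\<close> the number \<open>\<langle>y, v\<rangle> - c * (\<langle>u, y\<rangle> + \<langle>x, v\<rangle>)\<close> is nonnegative.
  The coefficient of \<open>c\<close> must therefore vanish, which says that \<open>(y, v)\<close> belongs to \<open>- A\<^sup>*\<close>.\<close>

lemma maximal_monotone_skew:
  fixes A :: "('a::real_inner \<times> 'a) set"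
  assumes A: "subspace A" "skew_rel A"
    and adj: "neg_rel (adjoint_rel A) \<subseteq> A"
  shows "maximal_monotone A"
  unfolding maximal_monotone_def
proof (intro conjI notI)
  show "monotone_rel A" using A by (rule skew_rel_imp_monotone_rel)
  assume "\<exists>B. monotone_rel B \<and> A \<subset> B"
  then obtain B where B: "monotone_rel B" "A \<subset> B" by blast
  then obtain y v where yv: "(y, v) \<in> B" "(y, v) \<notin> A" by auto
  have "inner x (- v) = inner u y" if xu: "(x, u) \<in> A" for x u
  proof -
    have lin: "inner (c *\<^sub>R x - y) (c *\<^sub>R u - v) = inner y v - c * (inner u y + inner x v)" for c
    proof -
      have "inner x u = 0" using A(2) xu by (auto simp: skew_rel_def)
      then show ?thesis by (simp add: inner_diff algebra_simps inner_commute)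
    qed
    have ge: "0 \<le> inner y v - c * (inner u y + inner x v)" for c
    proof -
      have "(c *\<^sub>R x, c *\<^sub>R u) \<in> B"
        using subspace_scale[OF A(1) xu, of c] B(2) by auto
      with B(1) yv(1) show ?thesis
        unfolding lin[symmetric] monotone_rel_def by fast
    qed
    let ?d = "inner u y + inner x v"
    have "?d = 0"
    proof (rule ccontr)
      assume "?d \<noteq> 0"
      \<comment> \<open>The affine function of \<open>c\<close> takes the value \<open>- 1\<close> here.\<close>
      then show False using ge[of "(inner y v + 1) / ?d"] by simp
    qed
    then show ?thesis by (simp add: inner_minus_right)
  qed
  then have "(y, v) \<in> neg_rel (adjoint_rel A)" by (auto simp: mem_adjoint_rel mem_neg_rel)
  with adj yv(2) show False by blast
qed

lemma maximal_monotone_neg_rel_skew: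
  assumes A: "subspace A" "skew_rel A" and adj: "neg_rel (adjoint_rel A) \<subseteq> A"
  shows "maximal_monotone (neg_rel A)"
proof (rule maximal_monotone_skew)
  show "neg_rel (adjoint_rel (neg_rel A)) \<subseteq> neg_rel A"
  proof clarify
    fix y v assume "(y, v) \<in> neg_rel (adjoint_rel (neg_rel A))"
    then have "(y, - v) \<in> neg_rel (adjoint_rel A)" by (simp add: adjoint_rel_neg_rel mem_neg_rel)
    with adj show "(y, v) \<in> neg_rel A" by (auto simp: mem_neg_rel)
  qed
  show "subspace (neg_rel A)" using A(1) by (rule subspace_neg_rel)
  show "skew_rel (neg_rel A)" using A(2) by (rule skew_rel_neg_rel)
qed

text \<open>If \<open>(y, v)\<close> is monotonically related to the graph of \<open>F\<^sup>-\<^sup>1\<close>, test it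
  against the point with second component \<open>v - s w\<close>, where \<open>w = F v - y\<close>. The result is
  \<open>0 \<le> - s * \<parallel>w\<parallel>\<^sup>2 + s\<^sup>2 * \<langle>F w, w\<rangle>\<close>, which fails for small positive \<open>s\<close> unless
  \<open>w = 0\<close>.\<close>

lemma maximal_monotone_converse_graph:
  fixes F :: "'a::real_inner \<Rightarrow> 'a"
  assumes F: "linear F" and pos: "\<And>x. 0 \<le> inner (F x) x"
  shows "maximal_monotone ((graph_of F)\<inverse>)"
  unfolding maximal_monotone_def
proof (intro conjI notI)
  show "monotone_rel ((graph_of F)\<inverse>)"
    using pos by (auto simp: monotone_rel_def graph_of_def linear_diff[OF F, symmetric])
  assume "\<exists>B. monotone_rel B \<and> (graph_of F)\<inverse> \<subset> B"
  then obtain B where B: "monotone_rel B" "(graph_of F)\<inverse> \<subset> B" by blast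
  then obtain y v where yv: "(y, v) \<in> B" "(y, v) \<notin> (graph_of F)\<inverse>" by auto
  define w where "w = F v - y"
  have "w \<noteq> 0" using yv(2) by (auto simp: w_def graph_of_def)
  then have pos_w: "0 < inner w w" by simp
  have ge: "0 \<le> - s * inner w w + s\<^sup>2 * inner (F w) w" for s
  proof -
    have "(F (v - s *\<^sub>R w), v - s *\<^sub>R w) \<in> B" using B(2) by (auto simp: graph_of_def)
    with B(1) yv(1) have "0 \<le> inner (F (v - s *\<^sub>R w) - y) (v - s *\<^sub>R w - v)"
      unfolding monotone_rel_def by fast
    also have "F (v - s *\<^sub>R w) - y = w - s *\<^sub>R F w"
      by (simp add: w_def linear_diff[OF F] linear_scale[OF F])
    also have "inner (w - s *\<^sub>R F w) (v - s *\<^sub>R w - v) = - s * inner w w + s\<^sup>2 * inner (F w) w"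
      by (simp add: inner_diff algebra_simps power2_eq_square)
    finally show ?thesis .
  qed
  show False
  proof (cases "inner (F w) w = 0")
    case True
    then show False using ge[of 1] pos_w by simp
  next
    case False
    then have q: "0 < inner (F w) w" using pos[of w] by simp
    \<comment> \<open>The minimizer of the quadratic in \<open>s\<close>.\<close>
    define s where "s = inner w w / (2 * inner (F w) w)"
    have "0 < s" using q pos_w by (simp add: s_def)
    have "- s * inner w w + s\<^sup>2 * inner (F w) w = - s * (inner w w / 2)"
      using q by (simp add: s_def power2_eq_square field_simps)
    also have "\<dots> < 0" using \<open>0 < s\<close> pos_w by simp
    finally show False using ge[of s] by simp
  qed
qed

section \<open>Adjoints and skew parts of the Volterra operator and its inverse\<close>

definition volterra_adj :: "L2 \<Rightarrow> L2" where
  "volterra_adj x = inner x one_L2 *\<^sub>R one_L2 - volterra x"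

lemma linear_volterra_adj: "linear volterra_adj"
  by (rule linearI)
    (simp_all add: volterra_adj_def volterra_add volterra_scaleR inner_add_left algebra_simps)

lemma inner_volterra_adj: "inner (volterra x) y = inner x (volterra_adj y)"
  using inner_volterra_symmetric_part[of x y]
  by (simp add: volterra_adj_def inner_diff_right algebra_simps)

lemma adjoint_rel_volterra: "adjoint_rel (graph_of volterra) = graph_of volterra_adj"
proof -
  have "(\<forall>a. inner a u = inner (volterra a) x) \<longleftrightarrow> u = volterra_adj x" for x u
    using vector_eq_ldot[of u "volterra_adj x"] by (auto simp: inner_volterra_adj)
  then show ?thesis
    by (auto simp: mem_adjoint_rel graph_of_def)
qed

lemma volterra_simps:
  "volterra 0 = 0" "volterra (- x) = - volterra x" "volterra (x - y) = volterra x - volterra y"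
  by (simp_all add: linear_0 linear_neg linear_diff linear_volterra)

text \<open>A point of \<open>dom T \<inter> dom T\<^sup>*\<close> is \<open>V a = V\<^sup>* b\<close>, that is
  \<open>V (a + b) = \<langle>b, 1\<rangle> 1\<close>. Since the range of \<open>V\<close> contains no nonzero constant, this forces
  \<open>b = - a\<close> and \<open>\<langle>a, 1\<rangle> = 0\<close>; so \<open>S\<close> is differentiation with zero boundary values at both
  ends.\<close>

lemma skew_part_inverse_volterra:
  "skew_part ((graph_of volterra)\<inverse>) = {(volterra a, a) | a. inner a one_L2 = 0}"
proof (intro set_eqI iffI; clarify)
  fix x w assume "(x, w) \<in> skew_part ((graph_of volterra)\<inverse>)"
  then obtain a b where ab: "x = volterra a" "x = volterra_adj b" "w = (1/2) *\<^sub>R (a - b)"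
    unfolding mem_skew_part adjoint_rel_converse adjoint_rel_volterra converse_iff mem_graph_of by blast
  have "volterra a = volterra_adj b" using ab(1,2) by (rule subst)
  then have "volterra (a + b) = inner b one_L2 *\<^sub>R one_L2"
    by (simp add: volterra_adj_def volterra_add)
  from volterra_eq_constant[OF this] have "b = - a" "inner b one_L2 = 0"
    by (simp_all add: add_eq_0_iff)
  then have "inner a one_L2 = 0" "w = a"
    using ab(3) by (simp_all add: scaleR_add_left[symmetric] flip: scaleR_2)
  with ab(1) show "\<exists>a. (x, w) = (volterra a, a) \<and> inner a one_L2 = 0" by blast
next
  fix a assume a: "inner a one_L2 = 0"
  have "volterra a = volterra_adj (- a)"
    using a by (simp add: volterra_adj_def volterra_simps)
  then have "(volterra a, (1/2) *\<^sub>R (a - (- a))) \<in> skew_part ((graph_of volterra)\<inverse>)"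
    unfolding mem_skew_part adjoint_rel_converse adjoint_rel_volterra converse_iff mem_graph_of by blast
  moreover have "(1/2) *\<^sub>R (a - (- a)) = a"
    by (simp flip: scaleR_2)
  ultimately show "(volterra a, a) \<in> skew_part ((graph_of volterra)\<inverse>)" by simp
qed

lemma skew_part_volterra:
  "skew_part (graph_of volterra) = graph_of (\<lambda>a. volterra a - (inner a one_L2 / 2) *\<^sub>R one_L2)"
proof -
  have "(1/2) *\<^sub>R (volterra a - volterra_adj a) = volterra a - (inner a one_L2 / 2) *\<^sub>R one_L2" for a
  proof -
    have "(1/2) *\<^sub>R (volterra a - volterra_adj a)
        = (1/2) *\<^sub>R (2 *\<^sub>R volterra a) - (1/2) *\<^sub>R (inner a one_L2 *\<^sub>R one_L2)"
      by (simp add: volterra_adj_def algebra_simps scaleR_2)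
    then show ?thesis by simp
  qed
  then show ?thesis
    by (auto simp: mem_skew_part adjoint_rel_volterra mem_graph_of)
qed

text \<open>For \<open>a\<close> orthogonal to \<open>1\<close> the rank-one term disappears and the adjoint condition reads
  \<open>\<langle>a, x + V u\<rangle> = 0\<close>. So \<open>x + V u\<close> is orthogonal to the complement of the constants; testing
  with its own component \<open>r\<close> in that complement shows that it is constant.\<close>

lemma adjoint_rel_minimal_derivative:
  "adjoint_rel {(volterra a, a) | a. inner a one_L2 = 0}
    = {(c *\<^sub>R one_L2 - volterra u, u) | c u. True}"
proof (intro set_eqI iffI; clarify)
  fix x u assume "(x, u) \<in> adjoint_rel {(volterra a, a) | a. inner a one_L2 = 0}"
  then have adj: "inner (volterra a) u = inner a x" if "inner a one_L2 = 0" for a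
    using that by (auto simp: mem_adjoint_rel)
  define w where "w = x + volterra u"
  define r where "r = w - inner w one_L2 *\<^sub>R one_L2"
  have r1: "inner r one_L2 = 0" by (simp add: r_def inner_diff_left)
  have "inner r w = 0"
    using adj[OF r1] r1 inner_volterra_symmetric_part[of r u] by (simp add: w_def inner_add_right)
  then have "inner r r = 0"
    using r1 by (subst (2) r_def) (simp add: inner_diff_right)
  then have "w = inner w one_L2 *\<^sub>R one_L2" by (simp add: r_def)
  then have "x = inner w one_L2 *\<^sub>R one_L2 - volterra u"
    unfolding w_def by (simp only: eq_diff_eq)
  then show "\<exists>c u'. (x, u) = (c *\<^sub>R one_L2 - volterra u', u') \<and> True" by blast
next
  fix c u
  have "inner (volterra a) u = inner a (c *\<^sub>R one_L2 - volterra u)" if "inner a one_L2 = 0" for a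
    using inner_volterra_symmetric_part[of a u] that by (simp add: inner_diff_right)
  then show "(c *\<^sub>R one_L2 - volterra u, u) \<in> adjoint_rel {(volterra a, a) | a. inner a one_L2 = 0}"
    by (auto simp: mem_adjoint_rel)
qed

theorem corollary4p10:
  fixes T S T\<^sub>1 T\<^sub>2 :: "(L2 \<times> L2) set"
  assumes T: "T = (graph_of volterra)\<inverse>"
    and S: "S = skew_part T"
    and T\<^sub>1: "T\<^sub>1 = periodic_derivative"
    and T\<^sub>2: "T\<^sub>2 = (skew_part (graph_of volterra))\<inverse>"
  shows "linear_operator S \<and> linear_operator T \<and> linear_operator T\<^sub>1 \<and> linear_operator T\<^sub>2 \<and>
    closure (Domain S) = UNIV \<and>
    \<not> maximal_monotone S \<and> \<not> maximal_monotone (neg_rel S) \<and>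
    \<not> monotone_rel (adjoint_rel S) \<and> \<not> monotone_rel (neg_rel (adjoint_rel S)) \<and>
    S \<subset> T \<and> T \<subset> neg_rel (adjoint_rel S) \<and>
    S \<subset> T\<^sub>1 \<and> T\<^sub>1 \<subset> neg_rel (adjoint_rel S) \<and>
    S \<subset> T\<^sub>2 \<and> T\<^sub>2 \<subset> neg_rel (adjoint_rel S) \<and>
    skew_rel S \<and>
    maximal_monotone T \<and> maximal_monotone T\<^sub>1 \<and> maximal_monotone T\<^sub>2 \<and>
    skew_rel T\<^sub>1 \<and> skew_rel T\<^sub>2 \<and>
    neg_rel S \<subset> adjoint_rel T \<and> adjoint_rel T \<subset> adjoint_rel S \<and>
    neg_rel S \<subset> neg_rel T\<^sub>1 \<and> neg_rel T\<^sub>1 \<subset> adjoint_rel S \<and>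
    neg_rel S \<subset> neg_rel T\<^sub>2 \<and> neg_rel T\<^sub>2 \<subset> adjoint_rel S \<and>
    skew_rel (neg_rel S) \<and>
    maximal_monotone (adjoint_rel T) \<and> maximal_monotone (neg_rel T\<^sub>1) \<and> maximal_monotone (neg_rel T\<^sub>2) \<and>
    skew_rel (neg_rel T\<^sub>1) \<and> skew_rel (neg_rel T\<^sub>2)"
proof -
  let ?o = "one_L2" and ?V = volterra
  have S_eq: "S = {(?V a, a) | a. inner a ?o = 0}"
    unfolding S T by (rule skew_part_inverse_volterra)
  have adjS_eq: "adjoint_rel S = {(c *\<^sub>R ?o - ?V u, u) | c u. True}"
    unfolding S_eq by (rule adjoint_rel_minimal_derivative)
  have adjT_eq: "adjoint_rel T = (graph_of volterra_adj)\<inverse>"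
    unfolding T adjoint_rel_converse adjoint_rel_volterra ..
  have mem_S: "(x, u) \<in> S \<longleftrightarrow> x = ?V u \<and> inner u ?o = 0" for x u
    by (auto simp: S_eq)
  have mem_T: "(x, u) \<in> T \<longleftrightarrow> x = ?V u" for x u
    by (auto simp: T mem_graph_of)
  have mem_T1: "(x, u) \<in> T\<^sub>1 \<longleftrightarrow> (\<exists>c. x = c *\<^sub>R ?o + ?V u) \<and> inner u ?o = 0" for x u
    by (auto simp: T\<^sub>1 periodic_derivative_eq)
  have mem_T2: "(x, u) \<in> T\<^sub>2 \<longleftrightarrow> x = ?V u - (inner u ?o / 2) *\<^sub>R ?o" for x u
    by (auto simp: T\<^sub>2 skew_part_volterra mem_graph_of)
  have mem_adjT: "(x, u) \<in> adjoint_rel T \<longleftrightarrow> x = inner u ?o *\<^sub>R ?o - ?V u" for x u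
    by (auto simp: adjT_eq mem_graph_of volterra_adj_def)
  have mem_adjS: "(x, u) \<in> adjoint_rel S \<longleftrightarrow> (\<exists>c. x = c *\<^sub>R ?o - ?V u)" for x u
    by (auto simp: adjS_eq)
  have mem_neg_adjS: "(x, u) \<in> neg_rel (adjoint_rel S) \<longleftrightarrow> (\<exists>c. x = c *\<^sub>R ?o + ?V u)" for x u
    by (simp add: mem_neg_rel mem_adjS volterra_simps)
  have mem_negS: "(x, u) \<in> neg_rel S \<longleftrightarrow> x = - ?V u \<and> inner u ?o = 0" for x u
    by (simp add: mem_neg_rel mem_S volterra_simps)
  note mem = mem_S mem_T mem_T1 mem_T2 mem_adjT mem_adjS mem_neg_adjS mem_negS

  have o_ne: "?o \<noteq> 0" by (metis inner_one_one inner_zero_left zero_neq_one)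
  have lin: "linear ?V" by (rule linear_volterra)
  \<comment> \<open>Adding a constant does not affect injectivity, because the range of \<open>V\<close> contains no nonzero constant.\<close>
  have V_inj: "a = b" if "?V a = ?V b + c *\<^sub>R ?o" for a b c
    using volterra_eq_constant(1)[of "a - b" c] that by (simp add: volterra_simps)
  have Vo: "2 * inner (?V ?o) ?o = 1" using inner_volterra_self[of ?o] by simp

  have linS: "linear_operator S"
    unfolding linear_operator_def
  proof
    show "subspace S"
      by (rule subspaceI) (auto simp: mem zero_prod_def volterra_simps volterra_add volterra_scaleR inner_add_left)
    show "single_valued S"
      using V_inj[where c = 0] by (auto simp: single_valued_def mem)
  qed
  have linT: "linear_operator T"
    unfolding linear_operator_def
  proof
    show "subspace T" unfolding T using linear_volterra by (rule subspace_converse_graph)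
    show "single_valued T"
      using V_inj[where c = 0] by (auto simp: single_valued_def mem)
  qed
  have linT1: "linear_operator T\<^sub>1"
    unfolding linear_operator_def
  proof
    show "subspace T\<^sub>1"
    proof (rule subspaceI)
      show "0 \<in> T\<^sub>1" by (auto simp: mem zero_prod_def volterra_simps intro: exI[of _ 0])
    next
      fix p q assume "p \<in> T\<^sub>1" "q \<in> T\<^sub>1"
      then obtain c d u v where p: "p = (c *\<^sub>R ?o + ?V u, u)" "inner u ?o = 0"
        and q: "q = (d *\<^sub>R ?o + ?V v, v)" "inner v ?o = 0"
        by (cases p, cases q) (auto simp: mem)
      have "fst (p + q) = (c + d) *\<^sub>R ?o + ?V (u + v)"
        by (simp add: p q volterra_add algebra_simps)
      with p q show "p + q \<in> T\<^sub>1" by (auto simp: mem inner_add_left)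
    next
      fix r p assume "p \<in> T\<^sub>1"
      then obtain c u where p: "p = (c *\<^sub>R ?o + ?V u, u)" "inner u ?o = 0"
        by (cases p) (auto simp: mem)
      have "fst (r *\<^sub>R p) = (r * c) *\<^sub>R ?o + ?V (r *\<^sub>R u)"
        by (simp add: p volterra_scaleR algebra_simps)
      with p show "r *\<^sub>R p \<in> T\<^sub>1" by (auto simp: mem)
    qed
    show "single_valued T\<^sub>1"
      unfolding single_valued_def
    proof (intro allI impI)
      fix x u v assume "(x, u) \<in> T\<^sub>1" "(x, v) \<in> T\<^sub>1"
      then obtain c d where "c *\<^sub>R ?o + ?V u = d *\<^sub>R ?o + ?V v" by (auto simp: mem)
      then have "?V u = ?V v + (d - c) *\<^sub>R ?o" by (simp add: algebra_simps)
      then show "u = v" by (rule V_inj)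
    qed
  qed
  have linT2: "linear_operator T\<^sub>2"
    unfolding linear_operator_def
  proof
    have "linear (\<lambda>a. ?V a - (inner a ?o / 2) *\<^sub>R ?o)"
      by (rule linearI)
        (simp_all add: volterra_add volterra_scaleR inner_add_left add_divide_distrib algebra_simps)
    then show "subspace T\<^sub>2" unfolding T\<^sub>2 skew_part_volterra by (rule subspace_converse_graph)
    show "single_valued T\<^sub>2"
      unfolding single_valued_def
    proof (intro allI impI)
      fix x u v assume xu: "(x, u) \<in> T\<^sub>2" and xv: "(x, v) \<in> T\<^sub>2"
      have "?V u = x + (inner u ?o / 2) *\<^sub>R ?o" using xu by (simp add: mem_T2)
      moreover have "?V v = x + (inner v ?o / 2) *\<^sub>R ?o" using xv by (simp add: mem_T2)
      ultimately have "?V u = ?V v + (inner u ?o / 2 - inner v ?o / 2) *\<^sub>R ?o"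
        by (simp add: scaleR_diff_left)
      then show "u = v" by (rule V_inj)
    qed
  qed

  have V_self: "inner (?V a) a = (inner a ?o)\<^sup>2 / 2" for a
    using inner_volterra_self[of a] by simp
  have skS: "skew_rel S"
    by (auto simp: skew_rel_def mem V_self)
  have skT1: "skew_rel T\<^sub>1"
    by (auto simp: skew_rel_def mem V_self inner_add_left inner_commute[of one_L2])
  have skT2: "skew_rel T\<^sub>2"
    by (auto simp: skew_rel_def mem V_self inner_diff_left inner_commute[of one_L2] power2_eq_square)

  have dom: "closure (Domain S) = UNIV"
  proof -
    have "Domain S = ?V ` {a. inner a ?o = 0}" by (auto simp: S_eq)
    then show ?thesis by (simp add: closure_volterra_image_orthogonal_one)
  qed

  \<comment> \<open>Every strict inclusion is witnessed by a pair whose second component is \<open>1\<close>, a function with nonzero integral, or by \<open>(1, 0)\<close>, the constant and its derivative.\<close>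
  have S_T: "S \<subset> T"
  proof
    show "S \<subseteq> T" by (auto simp: mem)
    have "(?V ?o, ?o) \<in> T - S" by (simp add: mem)
    then show "S \<noteq> T" by blast
  qed
  have T_M: "T \<subset> neg_rel (adjoint_rel S)"
  proof
    show "T \<subseteq> neg_rel (adjoint_rel S)" by (auto simp: mem intro: exI[of _ 0])
    have "(?o, 0) \<in> neg_rel (adjoint_rel S) - T"
      using o_ne by (auto simp: mem volterra_simps intro: exI[of _ 1])
    then show "T \<noteq> neg_rel (adjoint_rel S)" by blast
  qed
  have S_T1: "S \<subset> T\<^sub>1"
  proof
    show "S \<subseteq> T\<^sub>1" by (auto simp: mem intro: exI[of _ 0])
    have "(?o, 0) \<in> T\<^sub>1 - S"
      using o_ne by (auto simp: mem volterra_simps intro: exI[of _ 1])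
    then show "S \<noteq> T\<^sub>1" by blast
  qed
  have T1_M: "T\<^sub>1 \<subset> neg_rel (adjoint_rel S)"
  proof
    show "T\<^sub>1 \<subseteq> neg_rel (adjoint_rel S)" by (auto simp: mem)
    have "(?V ?o, ?o) \<in> neg_rel (adjoint_rel S) - T\<^sub>1"
      by (auto simp: mem intro: exI[of _ 0])
    then show "T\<^sub>1 \<noteq> neg_rel (adjoint_rel S)" by blast
  qed
  have S_T2: "S \<subset> T\<^sub>2"
  proof
    show "S \<subseteq> T\<^sub>2" by (auto simp: mem)
    have "(?V ?o - (1/2) *\<^sub>R ?o, ?o) \<in> T\<^sub>2 - S" by (simp add: mem)
    then show "S \<noteq> T\<^sub>2" by blast
  qed
  have T2_M: "T\<^sub>2 \<subset> neg_rel (adjoint_rel S)"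
  proof
    show "T\<^sub>2 \<subseteq> neg_rel (adjoint_rel S)"
    proof clarify
      fix x u assume "(x, u) \<in> T\<^sub>2"
      then have "x = (- (inner u ?o / 2)) *\<^sub>R ?o + ?V u" by (simp add: mem)
      then show "(x, u) \<in> neg_rel (adjoint_rel S)" unfolding mem by blast
    qed
    have "(?o, 0) \<in> neg_rel (adjoint_rel S) - T\<^sub>2"
      using o_ne by (auto simp: mem volterra_simps intro: exI[of _ 1])
    then show "T\<^sub>2 \<noteq> neg_rel (adjoint_rel S)" by blast
  qed
  have negS_adjT: "neg_rel S \<subset> adjoint_rel T"
  proof
    show "neg_rel S \<subseteq> adjoint_rel T" by (auto simp: mem volterra_simps)
    have "(?o - ?V ?o, ?o) \<in> adjoint_rel T - neg_rel S" by (simp add: mem)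
    then show "neg_rel S \<noteq> adjoint_rel T" by blast
  qed
  have adjT_adjS: "adjoint_rel T \<subset> adjoint_rel S"
  proof
    show "adjoint_rel T \<subseteq> adjoint_rel S" by (auto simp: mem)
    have "(?o, 0) \<in> adjoint_rel S - adjoint_rel T"
      using o_ne by (auto simp: mem volterra_simps intro: exI[of _ 1])
    then show "adjoint_rel T \<noteq> adjoint_rel S" by blast
  qed

  have maxT: "maximal_monotone T"
    unfolding T
  proof (rule maximal_monotone_converse_graph[OF lin])
    show "0 \<le> inner (?V x) x" for x by (simp add: V_self)
  qed
  have maxadjT: "maximal_monotone (adjoint_rel T)"
    unfolding adjT_eq
  proof (rule maximal_monotone_converse_graph[OF linear_volterra_adj])
    show "0 \<le> inner (volterra_adj x) x" for x
    proof -
      have eq: "inner (volterra_adj x) x = inner (?V x) x"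
        using inner_volterra_adj[of x x] by (simp only: inner_commute)
      show ?thesis unfolding eq V_self by simp
    qed
  qed
  have adj_of: "\<exists>c. y = c *\<^sub>R ?o + ?V v" if "(y, v) \<in> neg_rel (adjoint_rel A)" "S \<subseteq> A" for y v A
    using adjoint_rel_antimono[OF that(2)] that(1) mem_neg_adjS by (auto simp: mem_neg_rel)
  have "neg_rel (adjoint_rel T\<^sub>1) \<subseteq> T\<^sub>1"
  proof clarify
    fix y v assume yv: "(y, v) \<in> neg_rel (adjoint_rel T\<^sub>1)"
    \<comment> \<open>Testing against the constants recovers the periodicity condition.\<close>
    have "(?o, 0) \<in> T\<^sub>1" by (auto simp: mem volterra_simps intro: exI[of _ 1])
    with yv have "inner v ?o = 0" by (auto simp: mem_neg_rel mem_adjoint_rel inner_commute)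
    with adj_of[OF yv] S_T1 show "(y, v) \<in> T\<^sub>1" by (auto simp: mem_T1)
  qed
  then have maxT1: "maximal_monotone T\<^sub>1" "maximal_monotone (neg_rel T\<^sub>1)"
    using linT1 skT1
    by (auto simp: linear_operator_def intro: maximal_monotone_skew maximal_monotone_neg_rel_skew)
  have "neg_rel (adjoint_rel T\<^sub>2) \<subseteq> T\<^sub>2"
  proof clarify
    fix y v assume yv: "(y, v) \<in> neg_rel (adjoint_rel T\<^sub>2)"
    then obtain c where y: "y = c *\<^sub>R ?o + ?V v" using adj_of S_T2 by blast
    \<comment> \<open>Testing against the pair with second component \<open>1\<close> recovers the value of the integration constant.\<close>
    have "(?V ?o - (1/2) *\<^sub>R ?o, ?o) \<in> T\<^sub>2" by (simp add: mem)
    with yv have "inner (?V ?o - (1/2) *\<^sub>R ?o) (- v) = inner ?o y"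
      by (auto simp: mem_neg_rel mem_adjoint_rel)
    then have "c = - (inner v ?o / 2)"
      using inner_volterra_symmetric_part[of ?o v]
      by (simp add: y inner_diff_left inner_add_right inner_commute[of ?o v])
    then show "(y, v) \<in> T\<^sub>2" by (simp add: mem_T2 y)
  qed
  then have maxT2: "maximal_monotone T\<^sub>2" "maximal_monotone (neg_rel T\<^sub>2)"
    using linT2 skT2
    by (auto simp: linear_operator_def intro: maximal_monotone_skew maximal_monotone_neg_rel_skew)

  have not_max: "\<not> maximal_monotone S" "\<not> maximal_monotone (neg_rel S)"
  proof -
    have "monotone_rel T" "monotone_rel (adjoint_rel T)"
      using maxT maxadjT by (simp_all add: maximal_monotone_def)
    with S_T negS_adjT show "\<not> maximal_monotone S" "\<not> maximal_monotone (neg_rel S)"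
      unfolding maximal_monotone_def by blast+
  qed
  have not_mono: "\<not> monotone_rel A" if "(0, 0) \<in> A" "(x, u) \<in> A" "inner x u < 0"
    for A :: "(L2 \<times> L2) set" and x u
  proof
    assume "monotone_rel A"
    then have "0 \<le> inner (x - 0) (u - 0)"
      using that(1,2) unfolding monotone_rel_def by fast
    with that(3) show False by simp
  qed
  have "\<not> monotone_rel (adjoint_rel S)"
  proof (rule not_mono[where x = "- ?V ?o" and u = ?o])
    show "(0, 0) \<in> adjoint_rel S" "(- ?V ?o, ?o) \<in> adjoint_rel S"
      by (auto simp: mem volterra_simps intro: exI[of _ 0])
  qed (use Vo in simp)
  moreover have "\<not> monotone_rel (neg_rel (adjoint_rel S))"
  proof (rule not_mono[where x = "?V ?o - ?o" and u = ?o])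
    show "(0, 0) \<in> neg_rel (adjoint_rel S)"
      by (auto simp: mem volterra_simps intro: exI[of _ 0])
    have "?V ?o - ?o = (- 1) *\<^sub>R ?o + ?V ?o" by simp
    then show "(?V ?o - ?o, ?o) \<in> neg_rel (adjoint_rel S)" unfolding mem by blast
  qed (use Vo in \<open>simp add: inner_diff_left\<close>)
  moreover have "neg_rel S \<subset> neg_rel T\<^sub>1" "neg_rel S \<subset> neg_rel T\<^sub>2"
    using S_T1 S_T2 by (simp_all only: neg_rel_psubset_iff)
  moreover have "neg_rel T\<^sub>1 \<subset> adjoint_rel S" "neg_rel T\<^sub>2 \<subset> adjoint_rel S"
    using T1_M T2_M neg_rel_psubset_iff[of _ "neg_rel (adjoint_rel S)"] by simp_all
  ultimately show ?thesis
    using linS linT linT1 linT2 dom not_max S_T T_M S_T1 T1_M S_T2 T2_M skS skT1 skT2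
      maxT maxT1 maxT2 negS_adjT adjT_adjS maxadjT
      skS[THEN skew_rel_neg_rel] skT1[THEN skew_rel_neg_rel] skT2[THEN skew_rel_neg_rel]
    by - (intro conjI; assumption)
qed

end
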